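(* Let $\mathbb{F}$ be a field, $r>3$, and let $\mathcal{F}$ be a flag of length $r$ in $\mathbb{F}^{n}$ and $\mathcal{F}'$ a flag of length $r$ in $\mathbb{F}^{n'}$ (where $n,n'$ may differ). Then the semigroups $\varphi(\mathcal{F})\subseteq M(n,\mathbb{F})$ and $\varphi(\mathcal{F}')\subseteq M(n',\mathbb{F})$ are isomorphic if and only if $\mathrm{sig}(\mathcal{F})=\mathrm{sig}(\mathcal{F}')$.
   Context: $M(N,\mathbb{F})$ is the semigroup of $N\times N$ matrices over $\mathbb{F}$, identified with linear operators on $\mathbb{F}^N$. A flag of length $r$ in $\mathbb{F}^N$ is a chain $0=V_0\subsetneq V_1\subsetneq\cdots\subsetneq V_r=\mathbb{F}^N$ of subspaces; its signature is $\mathrm{sig}(\mathcal{F})=(d_1,\dots,d_r)$ with $d_i=\dim(V_i/V_{i-1})$. $\varphi(\mathcal{F})=\{a\in M(N,\mathbb{F}) : a(V_i)\subseteq V_{i-1}\text{ for all } i=1,\dots,r\}$; by the paper's results these are exactly the $r$-maximal nilpotent subsemigroups of $M(N,\mathbb{F})$. *)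

theory Defs
  imports "HOL-Analysis.Analysis"
begin

text \<open>Vectors of F^N are elements of type 'a^'n (N = CARD('n)); N x N matrices are 'a^'n^'n,
  acting on vectors by matrix-vector product. Subspaces and dimension are those of the
  vector space structure 'vec' over an arbitrary field 'a.\<close>

text \<open>A flag of length r: 0 = V 0, strictly increasing chain of subspaces, V r = whole space.\<close>
definition is_flag :: "nat \<Rightarrow> (nat \<Rightarrow> ('a::field ^ 'n) set) \<Rightarrow> bool" where
  "is_flag r V \<longleftrightarrow>
     V 0 = {0} \<and> V r = UNIV \<and> (\<forall>i\<le>r. vec.subspace (V i)) \<and>
     (\<forall>i\<in>{1..r}. V (i - 1) \<subset> V i)"

text \<open>Signature: d_i = dim (V_i / V_{i-1}) = dim V_i - dim V_{i-1}, i = 1..r.\<close>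
definition flag_sig :: "nat \<Rightarrow> (nat \<Rightarrow> ('a::field ^ 'n) set) \<Rightarrow> nat list" where
  "flag_sig r V = map (\<lambda>i. vec.dim (V (Suc i)) - vec.dim (V i)) [0..<r]"

definition flag_phi :: "nat \<Rightarrow> (nat \<Rightarrow> ('a::field ^ 'n) set) \<Rightarrow> ('a ^ 'n ^ 'n) set" where
  "flag_phi r V = {a. \<forall>i\<in>{1..r}. (\<lambda>x. a *v x) ` V i \<subseteq> V (i - 1)}"

text \<open>Isomorphism of multiplicative subsemigroups S, T (with matrix multiplication).\<close>
definition semigroup_iso_betw ::
  "('a::semiring_1 ^ 'n ^ 'n) set \<Rightarrow> ('a ^ 'm ^ 'm) set \<Rightarrow> ('a ^ 'n ^ 'n \<Rightarrow> 'a ^ 'm ^ 'm) \<Rightarrow> bool" where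
  "semigroup_iso_betw S T f \<longleftrightarrow> bij_betw f S T \<and> (\<forall>a\<in>S. \<forall>b\<in>S. f (a ** b) = f a ** f b)"

definition semigroups_isomorphic ::
  "('a::semiring_1 ^ 'n ^ 'n) set \<Rightarrow> ('a ^ 'm ^ 'm) set \<Rightarrow> bool" where
  "semigroups_isomorphic S T \<longleftrightarrow> (\<exists>f. semigroup_iso_betw S T f)"

end

theory Submission
  imports Defs
begin

(* Choosing a basis adapted to a flag conjugates phi(F) onto the semigroup of matrices a with
   a_pq \<noteq> 0 only if lev p < lev q, where the level function lev takes each value i exactly d_i
   times; permuting coordinates shows that equal signatures give isomorphic semigroups.
   Conversely every d_i is an isomorphism invariant. For 1 < t < r, d_t is the largest size of a
   biorthogonal system between the right annihilator of S^t and the left annihilator of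
   S^(r-t+1), since their products factor through the level-t coordinates. The bottom level is
   invisible to left multiplication, so d_1 is recovered from right ideals: for x supported in
   row level 1 and the two top column levels, x S is determined by the image under x of the
   coordinates of level below r, a subspace of the level-1 coordinates. Minimal such ideals are
   the points of the projective space on these coordinates, lines are cut out by elements with
   columns in levels 2 and 3 (below r - 1, hence r \<ge> 4), and d_1 is the size of a maximal
   independent set of points. Transposition reverses the levels and turns d_r into d_1. *)

section \<open>Invariants of semigroups with zero\<close>

fun rann :: "'x set \<Rightarrow> ('x \<Rightarrow> 'x \<Rightarrow> 'x) \<Rightarrow> 'x \<Rightarrow> nat \<Rightarrow> 'x set" where
  "rann S m z 0 = {z}"
| "rann S m z (Suc t) = {y \<in> S. \<forall>s\<in>S. m s y \<in> rann S m z t}"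

fun lann :: "'x set \<Rightarrow> ('x \<Rightarrow> 'x \<Rightarrow> 'x) \<Rightarrow> 'x \<Rightarrow> nat \<Rightarrow> 'x set" where
  "lann S m z 0 = {z}"
| "lann S m z (Suc t) = {x \<in> S. \<forall>s\<in>S. m x s \<in> lann S m z t}"

definition right_ideal :: "'x set \<Rightarrow> ('x \<Rightarrow> 'x \<Rightarrow> 'x) \<Rightarrow> 'x \<Rightarrow> 'x set" where
  "right_ideal S m x = m x ` S"

definition corner :: "'x set \<Rightarrow> ('x \<Rightarrow> 'x \<Rightarrow> 'x) \<Rightarrow> 'x \<Rightarrow> 'x set" where
  "corner S m z = rann S m z 1 \<inter> lann S m z 2"

definition points :: "'x set \<Rightarrow> ('x \<Rightarrow> 'x \<Rightarrow> 'x) \<Rightarrow> 'x \<Rightarrow> 'x set" where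
  "points S m z = {x \<in> corner S m z. right_ideal S m x \<noteq> right_ideal S m z \<and>
     (\<forall>y\<in>corner S m z. right_ideal S m y \<subseteq> right_ideal S m x \<longrightarrow>
        right_ideal S m y = right_ideal S m z \<or> right_ideal S m y = right_ideal S m x)}"

definition on_line :: "'x set \<Rightarrow> ('x \<Rightarrow> 'x \<Rightarrow> 'x) \<Rightarrow> 'x \<Rightarrow> 'x \<Rightarrow> 'x \<Rightarrow> 'x \<Rightarrow> bool" where
  "on_line S m z y y' x \<longleftrightarrow> x \<in> points S m z \<and> (\<forall>w\<in>rann S m z 1.
     right_ideal S m y \<subseteq> right_ideal S m w \<longrightarrow> right_ideal S m y' \<subseteq> right_ideal S m w \<longrightarrow>
     right_ideal S m x \<subseteq> right_ideal S m w)"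

inductive_set point_closure :: "'x set \<Rightarrow> ('x \<Rightarrow> 'x \<Rightarrow> 'x) \<Rightarrow> 'x \<Rightarrow> 'x set \<Rightarrow> 'x set"
  for S m z G where
  generator: "x \<in> G \<Longrightarrow> x \<in> points S m z \<Longrightarrow> x \<in> point_closure S m z G"
| line: "y \<in> point_closure S m z G \<Longrightarrow> y' \<in> point_closure S m z G \<Longrightarrow> on_line S m z y y' x \<Longrightarrow>
    x \<in> point_closure S m z G"

definition has_independent_points :: "'x set \<Rightarrow> ('x \<Rightarrow> 'x \<Rightarrow> 'x) \<Rightarrow> 'x \<Rightarrow> nat \<Rightarrow> bool" where
  "has_independent_points S m z k \<longleftrightarrow> (\<exists>x. (\<forall>i<k. x i \<in> points S m z) \<and>
     (\<forall>i<k. x i \<notin> point_closure S m z (x ` ({..<k} - {i}))))"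

definition has_biorthogonal_system :: "('x \<Rightarrow> 'x \<Rightarrow> 'x) \<Rightarrow> 'x \<Rightarrow> 'x set \<Rightarrow> 'x set \<Rightarrow> nat \<Rightarrow> bool" where
  "has_biorthogonal_system m z P Q k \<longleftrightarrow> (\<exists>x y. (\<forall>i<k. x i \<in> P \<and> y i \<in> Q) \<and>
     (\<forall>i<k. \<forall>j<k. m (y i) (x j) = z \<longleftrightarrow> i \<noteq> j))"

lemma point_closure_subset_points: "point_closure S m z G \<subseteq> points S m z"
  by (auto elim: point_closure.cases simp: on_line_def)

locale zero_semigroup =
  fixes S :: "'x set" and m :: "'x \<Rightarrow> 'x \<Rightarrow> 'x" and z :: 'x
  assumes closed: "a \<in> S \<Longrightarrow> b \<in> S \<Longrightarrow> m a b \<in> S"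
    and zero_in: "z \<in> S"
    and zero_left: "a \<in> S \<Longrightarrow> m z a = z" and zero_right: "a \<in> S \<Longrightarrow> m a z = z"
begin

lemma rann_subset: "rann S m z t \<subseteq> S"
  by (cases t) (auto simp: zero_in)

lemma lann_subset: "lann S m z t \<subseteq> S"
  by (cases t) (auto simp: zero_in)

lemma corner_subset: "corner S m z \<subseteq> S"
  using rann_subset by (auto simp: corner_def)

lemma points_subset: "points S m z \<subseteq> S"
  using corner_subset by (auto simp: points_def)

lemma right_ideal_subset: "x \<in> S \<Longrightarrow> right_ideal S m x \<subseteq> S"
  using closed by (auto simp: right_ideal_def)

end

locale zero_semigroup_iso =
  dom: zero_semigroup S m1 z1 + cod: zero_semigroup T m2 z2
  for S :: "'x set" and m1 z1 and T :: "'y set" and m2 z2 +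
  fixes f :: "'x \<Rightarrow> 'y"
  assumes bij: "bij_betw f S T"
    and hom: "a \<in> S \<Longrightarrow> b \<in> S \<Longrightarrow> f (m1 a b) = m2 (f a) (f b)"
begin

lemma f_in: "x \<in> S \<Longrightarrow> f x \<in> T"
  by (rule bij_betw_apply[OF bij])

lemma f_eq_iff: "x \<in> S \<Longrightarrow> y \<in> S \<Longrightarrow> f x = f y \<longleftrightarrow> x = y"
  using bij by (auto simp: bij_betw_def inj_on_eq_iff)

lemma image_eq: "f ` S = T"
  using bij by (simp add: bij_betw_def)

lemma ball_cod_iff: "(\<forall>y\<in>T. P y) \<longleftrightarrow> (\<forall>x\<in>S. P (f x))"
  unfolding image_eq[symmetric] by simp

lemma f_zero: "f z1 = z2"
proof -
  obtain x where x: "x \<in> S" "z2 = f x"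
    using cod.zero_in image_eq by blast
  have "f z1 = f (m1 x z1)" using x dom.zero_right dom.zero_in by simp
  also have "\<dots> = z2" using x hom dom.zero_in f_in cod.zero_left by simp
  finally show ?thesis .
qed

lemma inverse_iso: "zero_semigroup_iso T m2 z2 S m1 z1 (inv_into S f)"
proof unfold_locales
  show "bij_betw (inv_into S f) T S" using bij by (rule bij_betw_inv_into)
  fix a b assume "a \<in> T" "b \<in> T"
  then obtain x y where "x \<in> S" "y \<in> S" "a = f x" "b = f y"
    using image_eq by blast
  then show "inv_into S f (m2 a b) = m1 (inv_into S f a) (inv_into S f b)"
    using hom[symmetric] dom.closed bij by (simp add: bij_betw_def)
qed

lemma rann_iff: "x \<in> S \<Longrightarrow> f x \<in> rann T m2 z2 t \<longleftrightarrow> x \<in> rann S m1 z1 t"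
proof (induction t arbitrary: x)
  case 0
  then show ?case using f_eq_iff[OF _ dom.zero_in] f_zero by auto
next
  case (Suc t)
  have "(\<forall>s\<in>T. m2 s (f x) \<in> rann T m2 z2 t) \<longleftrightarrow> (\<forall>s\<in>S. m2 (f s) (f x) \<in> rann T m2 z2 t)"
    by (rule ball_cod_iff)
  also have "\<dots> \<longleftrightarrow> (\<forall>s\<in>S. m1 s x \<in> rann S m1 z1 t)"
    using Suc dom.closed by (auto simp: hom[symmetric])
  finally show ?case using Suc f_in by simp
qed

lemma lann_iff: "x \<in> S \<Longrightarrow> f x \<in> lann T m2 z2 t \<longleftrightarrow> x \<in> lann S m1 z1 t"
proof (induction t arbitrary: x)
  case 0
  then show ?case using f_eq_iff[OF _ dom.zero_in] f_zero by auto
next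
  case (Suc t)
  have "(\<forall>s\<in>T. m2 (f x) s \<in> lann T m2 z2 t) \<longleftrightarrow> (\<forall>s\<in>S. m2 (f x) (f s) \<in> lann T m2 z2 t)"
    by (rule ball_cod_iff)
  also have "\<dots> \<longleftrightarrow> (\<forall>s\<in>S. m1 x s \<in> lann S m1 z1 t)"
    using Suc dom.closed by (auto simp: hom[symmetric])
  finally show ?case using Suc f_in by simp
qed

lemma corner_iff: "x \<in> S \<Longrightarrow> f x \<in> corner T m2 z2 \<longleftrightarrow> x \<in> corner S m1 z1"
  using rann_iff[of x 1] lann_iff[of x 2] by (simp add: corner_def)

lemma right_ideal_image: "x \<in> S \<Longrightarrow> right_ideal T m2 (f x) = f ` right_ideal S m1 x"
  unfolding right_ideal_def image_eq[symmetric] image_image using hom by auto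

lemma right_ideal_subset_iff:
  "x \<in> S \<Longrightarrow> y \<in> S \<Longrightarrow> right_ideal T m2 (f x) \<subseteq> right_ideal T m2 (f y) \<longleftrightarrow>
     right_ideal S m1 x \<subseteq> right_ideal S m1 y"
  unfolding right_ideal_image using bij dom.right_ideal_subset
  by (intro inj_on_image_subset_iff) (auto simp: bij_betw_def)

lemma right_ideal_eq_iff:
  "x \<in> S \<Longrightarrow> y \<in> S \<Longrightarrow> right_ideal T m2 (f x) = right_ideal T m2 (f y) \<longleftrightarrow>
     right_ideal S m1 x = right_ideal S m1 y"
  using right_ideal_subset_iff by blast

lemma image_eq_if_iff:
  assumes "A \<subseteq> S" "B \<subseteq> T" "\<And>x. x \<in> S \<Longrightarrow> f x \<in> B \<longleftrightarrow> x \<in> A"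
  shows "f ` A = B"
  using assms image_eq by blast

lemma ball_corner_iff: "(\<forall>y\<in>corner T m2 z2. P y) \<longleftrightarrow> (\<forall>x\<in>corner S m1 z1. P (f x))"
proof -
  have "f ` corner S m1 z1 = corner T m2 z2"
    using dom.corner_subset cod.corner_subset corner_iff by (rule image_eq_if_iff)
  from this[symmetric] show ?thesis by simp
qed

lemma ball_rann_iff: "(\<forall>y\<in>rann T m2 z2 t. P y) \<longleftrightarrow> (\<forall>x\<in>rann S m1 z1 t. P (f x))"
proof -
  have "f ` rann S m1 z1 t = rann T m2 z2 t"
    using dom.rann_subset cod.rann_subset rann_iff by (rule image_eq_if_iff)
  from this[symmetric] show ?thesis by simp
qed

lemma points_iff:
  assumes x: "x \<in> S"
  shows "f x \<in> points T m2 z2 \<longleftrightarrow> x \<in> points S m1 z1"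
proof -
  have minimal_iff:
    "(right_ideal T m2 (f y) \<subseteq> right_ideal T m2 (f x) \<longrightarrow>
       right_ideal T m2 (f y) = right_ideal T m2 z2 \<or> right_ideal T m2 (f y) = right_ideal T m2 (f x)) \<longleftrightarrow>
     (right_ideal S m1 y \<subseteq> right_ideal S m1 x \<longrightarrow>
       right_ideal S m1 y = right_ideal S m1 z1 \<or> right_ideal S m1 y = right_ideal S m1 x)"
    if "y \<in> corner S m1 z1" for y
  proof -
    have y: "y \<in> S" using that dom.corner_subset by blast
    show ?thesis
      by (simp add: f_zero[symmetric] right_ideal_subset_iff[OF y x] right_ideal_eq_iff[OF y x]
          right_ideal_eq_iff[OF y dom.zero_in])
  qed
  have "right_ideal T m2 (f x) \<noteq> right_ideal T m2 z2 \<longleftrightarrow> right_ideal S m1 x \<noteq> right_ideal S m1 z1"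
    using right_ideal_eq_iff[OF x dom.zero_in] by (simp add: f_zero)
  then show ?thesis
    unfolding points_def mem_Collect_eq ball_corner_iff
    using corner_iff[OF x] minimal_iff by (simp cong: ball_cong)
qed

lemma on_line_iff:
  assumes "x \<in> S" "y \<in> S" "y' \<in> S"
  shows "on_line T m2 z2 (f y) (f y') (f x) \<longleftrightarrow> on_line S m1 z1 y y' x"
proof -
  have "(right_ideal T m2 (f y) \<subseteq> right_ideal T m2 (f w) \<longrightarrow>
         right_ideal T m2 (f y') \<subseteq> right_ideal T m2 (f w) \<longrightarrow>
         right_ideal T m2 (f x) \<subseteq> right_ideal T m2 (f w)) \<longleftrightarrow>
        (right_ideal S m1 y \<subseteq> right_ideal S m1 w \<longrightarrow> right_ideal S m1 y' \<subseteq> right_ideal S m1 w \<longrightarrow>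
         right_ideal S m1 x \<subseteq> right_ideal S m1 w)"
    if "w \<in> rann S m1 z1 1" for w
  proof -
    have w: "w \<in> S" using that dom.rann_subset by blast
    show ?thesis
      by (simp add: right_ideal_subset_iff[OF assms(2) w] right_ideal_subset_iff[OF assms(3) w]
          right_ideal_subset_iff[OF assms(1) w])
  qed
  then show ?thesis
    unfolding on_line_def ball_rann_iff using points_iff[OF assms(1)] by (simp cong: ball_cong del: rann.simps)
qed

lemma image_point_closure_subset:
  assumes "G \<subseteq> S"
  shows "f ` point_closure S m1 z1 G \<subseteq> point_closure T m2 z2 (f ` G)"
proof clarify
  fix x assume "x \<in> point_closure S m1 z1 G"
  then show "f x \<in> point_closure T m2 z2 (f ` G)"
  proof (induction rule: point_closure.induct)
    case (generator x)
    then have "x \<in> S" using dom.points_subset by blast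
    then show ?case using generator by (intro point_closure.generator) (simp_all add: points_iff)
  next
    case (line y y' x)
    have "x \<in> points S m1 z1" using line.hyps(3) by (simp add: on_line_def)
    moreover have "y \<in> points S m1 z1" "y' \<in> points S m1 z1"
      using line.hyps(1,2) point_closure_subset_points[of S m1 z1 G] by auto
    ultimately have "x \<in> S" "y \<in> S" "y' \<in> S" using dom.points_subset by blast+
    then have "on_line T m2 z2 (f y) (f y') (f x)" using line.hyps(3) by (simp add: on_line_iff)
    then show ?case using line.IH by (rule point_closure.line[rotated 2])
  qed
qed

lemma point_closure_iff:
  assumes G: "G \<subseteq> S" and x: "x \<in> S"
  shows "f x \<in> point_closure T m2 z2 (f ` G) \<longleftrightarrow> x \<in> point_closure S m1 z1 G"
proof
  interpret inv: zero_semigroup_iso T m2 z2 S m1 z1 "inv_into S f" by (rule inverse_iso)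
  have inv_f: "inv_into S f (f a) = a" if "a \<in> S" for a
    using bij that by (simp add: bij_betw_def)
  have "inv_into S f ` f ` G = G"
    using G inv_f by (force simp: image_image)
  moreover have "f ` G \<subseteq> T" using G f_in by blast
  ultimately have "inv_into S f ` point_closure T m2 z2 (f ` G) \<subseteq> point_closure S m1 z1 G"
    using inv.image_point_closure_subset by metis
  moreover assume "f x \<in> point_closure T m2 z2 (f ` G)"
  ultimately show "x \<in> point_closure S m1 z1 G" using inv_f[OF x] by force
next
  assume "x \<in> point_closure S m1 z1 G"
  then show "f x \<in> point_closure T m2 z2 (f ` G)" using image_point_closure_subset[OF G] by blast
qed

lemma has_independent_points_transfer:
  assumes "has_independent_points S m1 z1 k"
  shows "has_independent_points T m2 z2 k"
proof -
  obtain x where points: "\<forall>i<k. x i \<in> points S m1 z1"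
    and indep: "\<forall>i<k. x i \<notin> point_closure S m1 z1 (x ` ({..<k} - {i}))"
    using assms unfolding has_independent_points_def by blast
  have in_S: "i < k \<Longrightarrow> x i \<in> S" for i using points dom.points_subset by blast
  have "f (x i) \<notin> point_closure T m2 z2 ((f \<circ> x) ` ({..<k} - {i}))" if "i < k" for i
  proof -
    have "x ` ({..<k} - {i}) \<subseteq> S" using in_S by blast
    then show ?thesis
      using point_closure_iff[of _ "x i"] in_S indep that image_comp[of f x] by metis
  qed
  then show ?thesis
    unfolding has_independent_points_def using points in_S points_iff
    by (intro exI[of _ "f \<circ> x"]) auto
qed

lemma has_independent_points_iff:
  "has_independent_points T m2 z2 k \<longleftrightarrow> has_independent_points S m1 z1 k"
  using has_independent_points_transfer zero_semigroup_iso.has_independent_points_transfer[OF inverse_iso]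
  by blast

lemma has_biorthogonal_system_transfer:
  assumes "has_biorthogonal_system m1 z1 (rann S m1 z1 t) (lann S m1 z1 t') k"
  shows "has_biorthogonal_system m2 z2 (rann T m2 z2 t) (lann T m2 z2 t') k"
proof -
  obtain x y where mem: "\<forall>i<k. x i \<in> rann S m1 z1 t \<and> y i \<in> lann S m1 z1 t'"
    and orth: "\<forall>i<k. \<forall>j<k. m1 (y i) (x j) = z1 \<longleftrightarrow> i \<noteq> j"
    using assms unfolding has_biorthogonal_system_def by blast
  have in_S: "i < k \<Longrightarrow> x i \<in> S \<and> y i \<in> S" for i
    using mem dom.rann_subset dom.lann_subset by blast
  have "m2 (f (y i)) (f (x j)) = z2 \<longleftrightarrow> i \<noteq> j" if "i < k" "j < k" for i j
    using that in_S orth f_eq_iff[OF dom.closed dom.zero_in] by (simp add: hom[symmetric] f_zero[symmetric])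
  then show ?thesis
    unfolding has_biorthogonal_system_def using mem in_S rann_iff lann_iff
    by (intro exI[of _ "f \<circ> x"] exI[of _ "f \<circ> y"]) auto
qed

lemma has_biorthogonal_system_iff:
  "has_biorthogonal_system m2 z2 (rann T m2 z2 t) (lann T m2 z2 t') k \<longleftrightarrow>
     has_biorthogonal_system m1 z1 (rann S m1 z1 t) (lann S m1 z1 t') k"
  using has_biorthogonal_system_transfer zero_semigroup_iso.has_biorthogonal_system_transfer[OF inverse_iso]
  by blast

end

section \<open>Matrices strictly increasing a level function\<close>

lemma matrix_mult_nonzero_entry:
  fixes a :: "'a::semiring_1^'k::finite^'m" and b :: "'a^'n^'k"
  assumes "(a ** b) $ p $ q \<noteq> 0"
  obtains k where "a $ p $ k \<noteq> 0" "b $ k $ q \<noteq> 0"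
proof -
  have "(\<Sum>k\<in>UNIV. a $ p $ k * b $ k $ q) \<noteq> 0"
    using assms by (simp add: matrix_matrix_mult_def)
  then obtain k where "a $ p $ k * b $ k $ q \<noteq> 0" by (meson sum.neutral)
  then show ?thesis using that by (metis mult_zero_left mult_zero_right)
qed

lemma matrix_vector_mult_nonzero_entry:
  fixes a :: "'a::semiring_1^'n::finite^'m" and v :: "'a^'n"
  assumes "(a *v v) $ p \<noteq> 0"
  obtains k where "a $ p $ k \<noteq> 0" "v $ k \<noteq> 0"
proof -
  have "(\<Sum>k\<in>UNIV. a $ p $ k * v $ k) \<noteq> 0"
    using assms by (simp add: matrix_vector_mult_def)
  then obtain k where "a $ p $ k * v $ k \<noteq> 0" by (meson sum.neutral)
  then show ?thesis using that by (metis mult_zero_left mult_zero_right)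
qed

lemma column_matrix_mult: "column q (a ** b) = a *v column q b"
  by (simp add: vec_eq_iff column_def matrix_matrix_mult_def matrix_vector_mult_def)

lemma matrix_vector_mult_axis_one: "a *v axis k 1 = column k (a :: 'a::semiring_1^'n::finite^'m)"
  by (simp add: vec_eq_iff matrix_vector_mult_def column_def axis_def if_distrib[of "\<lambda>x. _ * x"]
      cong: if_cong)

lemma column_zero [simp]: "column q 0 = 0"
  by (simp add: column_def vec_eq_iff)

lemma matrix_eq_iff_columns: "a = b \<longleftrightarrow> (\<forall>q. column q a = column q b)"
  by (auto simp: vec_eq_iff column_def)

definition col_mat :: "'n \<Rightarrow> 'a::zero^'m \<Rightarrow> 'a^'n^'m" where
  "col_mat q v = (\<chi> i j. if j = q then v $ i else 0)"

lemma col_mat_nth [simp]: "col_mat q v $ i $ j = (if j = q then v $ i else 0)"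
  by (simp add: col_mat_def)

lemma column_col_mat [simp]: "column q (col_mat q v) = v"
  by (simp add: column_def vec_eq_iff)

lemma col_mat_mult_vec: "col_mat q v *v u = (u $ q) *s (v :: 'a::comm_semiring_1^'m)"
  unfolding vec_eq_iff matrix_vector_mult_def
  by (simp add: if_distrib[of "\<lambda>x. x * _"] cong: if_cong) (simp add: mult.commute)

lemma col_mat_mult_left: "(col_mat k v ** a) $ i $ j = v $ i * a $ k $ j"
  by (simp add: matrix_matrix_mult_def if_distrib[of "\<lambda>x. x * _"] cong: if_cong)

lemma mult_col_mat: "a ** col_mat q v = col_mat q (a *v v)"
  by (simp add: matrix_eq_iff_columns column_matrix_mult)
    (simp add: column_def vec_eq_iff matrix_vector_mult_def)

lemma col_mat_eq_0_iff [simp]: "col_mat q v = 0 \<longleftrightarrow> v = 0"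
  by (metis column_col_mat col_mat_nth vec_eq_iff zero_index)

lemma col_mat_mult_col_mat: "col_mat q v ** col_mat q' w = col_mat q' (w $ q *s (v :: 'a::comm_semiring_1^'m))"
  by (simp add: mult_col_mat col_mat_mult_vec)

text \<open>\<open>coord_phi lev\<close> is \<open>flag_phi\<close> of the coordinate flag \<open>coord_flag lev\<close>
  (lemma \<open>flag_phi_coord_flag\<close>).\<close>
definition coord_phi :: "('n \<Rightarrow> nat) \<Rightarrow> ('a::zero^'n^'n) set" where
  "coord_phi lev = {a. \<forall>p q. a $ p $ q \<noteq> 0 \<longrightarrow> lev p < lev q}"

definition coord_flag :: "('n \<Rightarrow> nat) \<Rightarrow> nat \<Rightarrow> ('a::zero^'n) set" where
  "coord_flag lev j = {v. \<forall>p. v $ p \<noteq> 0 \<longrightarrow> lev p \<le> j}"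

lemma zero_in_coord_phi: "0 \<in> coord_phi lev"
  by (simp add: coord_phi_def)

lemma coord_phi_mult:
  assumes "a \<in> coord_phi lev" "b \<in> coord_phi lev"
  shows "a ** b \<in> coord_phi lev"
  unfolding coord_phi_def
proof (intro CollectI allI impI)
  fix p q assume "(a ** b) $ p $ q \<noteq> 0"
  then obtain k where "a $ p $ k \<noteq> 0" "b $ k $ q \<noteq> 0" by (rule matrix_mult_nonzero_entry)
  then have "lev p < lev k" "lev k < lev q" using assms by (auto simp: coord_phi_def)
  then show "lev p < lev q" by simp
qed

lemma zero_semigroup_coord_phi: "zero_semigroup (coord_phi lev) (**) (0::'a::semiring_1^'n::finite^'n)"
  by unfold_locales (simp_all add: coord_phi_mult zero_in_coord_phi)

lemmas rann_coord_phi_subset = zero_semigroup.rann_subset[OF zero_semigroup_coord_phi]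

lemma col_mat_in_coord_phi_iff: "col_mat q v \<in> coord_phi lev \<longleftrightarrow> (\<forall>p. v $ p \<noteq> 0 \<longrightarrow> lev p < lev q)"
  by (auto simp: coord_phi_def)

lemma col_mat_axis_in_coord_phi: "lev p < lev q \<Longrightarrow> col_mat q (axis p 1) \<in> coord_phi lev"
  by (simp add: col_mat_in_coord_phi_iff axis_def)

lemma subspace_coord_flag: "vec.subspace (coord_flag lev j)"
  unfolding vec.subspace_def coord_flag_def by (auto; metis add.right_neutral)

locale levels =
  fixes lev :: "'n::finite \<Rightarrow> nat" and r :: nat
  assumes lev_pos: "1 \<le> lev p" and lev_le: "lev p \<le> r"
    and lev_surj: "1 \<le> i \<Longrightarrow> i \<le> r \<Longrightarrow> \<exists>p. lev p = i"
begin

lemma level_set_empty: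
  assumes "i < 1 \<or> r < i"
  shows "{p. lev p = i} = {}"
proof -
  have "lev p \<noteq> i" for p using assms lev_pos[of p] lev_le[of p] by linarith
  then show ?thesis by blast
qed

lemma obtain_level:
  assumes "1 \<le> i" "i \<le> r"
  obtains p where "lev p = i"
  using lev_surj[OF assms] by blast

lemma left_mult_rows_le_iff:
  "(\<forall>s\<in>coord_phi lev. \<forall>p q. (s ** y) $ p $ q \<noteq> 0 \<longrightarrow> lev p \<le> t) \<longleftrightarrow>
    (\<forall>p q. y $ p $ q \<noteq> (0::'a::semiring_1) \<longrightarrow> lev p \<le> Suc t)"
proof (intro iffI allI impI ballI)
  fix k q assume rows: "\<forall>s\<in>coord_phi lev. \<forall>p q. (s ** y) $ p $ q \<noteq> 0 \<longrightarrow> lev p \<le> t"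
    and nz: "y $ k $ q \<noteq> 0"
  show "lev k \<le> Suc t"
  proof (rule ccontr)
    assume "\<not> lev k \<le> Suc t"
    then have "1 \<le> Suc t" "Suc t \<le> r" using lev_le[of k] by simp_all
    then obtain p where p: "lev p = Suc t" by (rule obtain_level)
    then have "col_mat k (axis p 1) \<in> coord_phi lev"
      using \<open>\<not> lev k \<le> Suc t\<close> by (intro col_mat_axis_in_coord_phi) simp
    moreover have "(col_mat k (axis p 1) ** y) $ p $ q \<noteq> 0"
      using nz by (simp add: col_mat_mult_left)
    ultimately have "lev p \<le> t" using rows by blast
    then show False using p by simp
  qed
next
  fix s p q assume rows: "\<forall>p q. y $ p $ q \<noteq> 0 \<longrightarrow> lev p \<le> Suc t"
    and s: "s \<in> coord_phi lev" and nz: "(s ** y) $ p $ q \<noteq> 0"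
  obtain k where "s $ p $ k \<noteq> 0" "y $ k $ q \<noteq> 0"
    using nz by (rule matrix_mult_nonzero_entry)
  then have "lev p < lev k" "lev k \<le> Suc t" using s rows by (auto simp: coord_phi_def)
  then show "lev p \<le> t" by simp
qed

lemma right_mult_cols_gt_iff:
  "(\<forall>s\<in>coord_phi lev. \<forall>p q. (x ** s) $ p $ q \<noteq> 0 \<longrightarrow> r - t < lev q) \<longleftrightarrow>
    (\<forall>p q. x $ p $ q \<noteq> (0::'a::semiring_1) \<longrightarrow> r - Suc t < lev q)"
proof (intro iffI allI impI ballI)
  fix p k assume cols: "\<forall>s\<in>coord_phi lev. \<forall>p q. (x ** s) $ p $ q \<noteq> 0 \<longrightarrow> r - t < lev q"
    and nz: "x $ p $ k \<noteq> 0"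
  show "r - Suc t < lev k"
  proof (rule ccontr)
    assume "\<not> r - Suc t < lev k"
    then have "lev k < r - t" using lev_pos[of k] by linarith
    then have "1 \<le> r - t" "r - t \<le> r" by simp_all
    then obtain q where q: "lev q = r - t" by (rule obtain_level)
    then have "col_mat q (axis k 1) \<in> coord_phi lev"
      using \<open>lev k < r - t\<close> by (intro col_mat_axis_in_coord_phi) simp
    moreover have "(x ** col_mat q (axis k 1)) $ p $ q \<noteq> 0"
      using nz by (simp add: mult_col_mat matrix_vector_mult_axis_one column_def)
    ultimately have "r - t < lev q" using cols by blast
    then show False using q by simp
  qed
next
  fix s p q assume cols: "\<forall>p q. x $ p $ q \<noteq> 0 \<longrightarrow> r - Suc t < lev q"
    and s: "s \<in> coord_phi lev" and nz: "(x ** s) $ p $ q \<noteq> 0"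
  obtain k where "x $ p $ k \<noteq> 0" "s $ k $ q \<noteq> 0"
    using nz by (rule matrix_mult_nonzero_entry)
  then have "r - Suc t < lev k" "lev k < lev q" using s cols by (auto simp: coord_phi_def)
  then show "r - t < lev q" by linarith
qed

lemma rann_coord_phi:
  "rann (coord_phi lev) (**) (0::'a::semiring_1^'n^'n) t =
     {y \<in> coord_phi lev. \<forall>p q. y $ p $ q \<noteq> 0 \<longrightarrow> lev p \<le> t}"
proof (induction t)
  case 0
  have "y = 0" if "\<forall>p q. y $ p $ q \<noteq> 0 \<longrightarrow> lev p \<le> 0" for y :: "'a^'n^'n"
  proof -
    have "y $ p $ q = 0" for p q using that lev_pos[of p] by auto
    then show ?thesis by (simp add: vec_eq_iff)
  qed
  then show ?case using zero_in_coord_phi by auto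
next
  case (Suc t)
  show ?case
  proof (rule set_eqI)
    fix y :: "'a^'n^'n"
    have "y \<in> rann (coord_phi lev) (**) 0 (Suc t) \<longleftrightarrow>
        y \<in> coord_phi lev \<and> (\<forall>s\<in>coord_phi lev. s ** y \<in> rann (coord_phi lev) (**) 0 t)"
      by (simp only: rann.simps mem_Collect_eq)
    also have "\<dots> \<longleftrightarrow> y \<in> coord_phi lev \<and>
        (\<forall>s\<in>coord_phi lev. \<forall>p q. (s ** y) $ p $ q \<noteq> 0 \<longrightarrow> lev p \<le> t)"
      unfolding Suc.IH using coord_phi_mult by blast
    also have "\<dots> \<longleftrightarrow> y \<in> {y \<in> coord_phi lev. \<forall>p q. y $ p $ q \<noteq> 0 \<longrightarrow> lev p \<le> Suc t}"
      using left_mult_rows_le_iff by blast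
    finally show "y \<in> rann (coord_phi lev) (**) 0 (Suc t) \<longleftrightarrow>
        y \<in> {y \<in> coord_phi lev. \<forall>p q. y $ p $ q \<noteq> 0 \<longrightarrow> lev p \<le> Suc t}" .
  qed
qed

lemma lann_coord_phi:
  "lann (coord_phi lev) (**) (0::'a::semiring_1^'n^'n) t =
     {x \<in> coord_phi lev. \<forall>p q. x $ p $ q \<noteq> 0 \<longrightarrow> r - t < lev q}"
proof (induction t)
  case 0
  have "x = 0" if "\<forall>p q. x $ p $ q \<noteq> 0 \<longrightarrow> r - 0 < lev q" for x :: "'a^'n^'n"
  proof -
    have "x $ p $ q = 0" for p q using that lev_le[of q] by (metis diff_zero leD)
    then show ?thesis by (simp add: vec_eq_iff)
  qed
  then show ?case using zero_in_coord_phi by auto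
next
  case (Suc t)
  show ?case
  proof (rule set_eqI)
    fix x :: "'a^'n^'n"
    have "x \<in> lann (coord_phi lev) (**) 0 (Suc t) \<longleftrightarrow>
        x \<in> coord_phi lev \<and> (\<forall>s\<in>coord_phi lev. x ** s \<in> lann (coord_phi lev) (**) 0 t)"
      by (simp only: lann.simps mem_Collect_eq)
    also have "\<dots> \<longleftrightarrow> x \<in> coord_phi lev \<and>
        (\<forall>s\<in>coord_phi lev. \<forall>p q. (x ** s) $ p $ q \<noteq> 0 \<longrightarrow> r - t < lev q)"
      unfolding Suc.IH using coord_phi_mult by blast
    also have "\<dots> \<longleftrightarrow> x \<in> {x \<in> coord_phi lev. \<forall>p q. x $ p $ q \<noteq> 0 \<longrightarrow> r - Suc t < lev q}"
      using right_mult_cols_gt_iff by blast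
    finally show "x \<in> lann (coord_phi lev) (**) 0 (Suc t) \<longleftrightarrow>
        x \<in> {x \<in> coord_phi lev. \<forall>p q. x $ p $ q \<noteq> 0 \<longrightarrow> r - Suc t < lev q}" .
  qed
qed

end

section \<open>Biorthogonal systems and the middle levels\<close>

lemma card_le_dim_if_not_in_span_others:
  fixes u :: "nat \<Rightarrow> 'a::field^'n::finite"
  assumes in_U: "\<And>i. i < k \<Longrightarrow> u i \<in> U"
    and not_in_span: "\<And>i. i < k \<Longrightarrow> u i \<notin> vec.span (u ` ({..<k} - {i}))"
  shows "k \<le> vec.dim U"
proof -
  have inj: "inj_on u {..<k}"
  proof (rule inj_onI)
    fix i j assume i: "i \<in> {..<k}" and j: "j \<in> {..<k}" and eq: "u i = u j"
    show "i = j"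
    proof (rule ccontr)
      assume "i \<noteq> j"
      then have "u i \<in> u ` ({..<k} - {i})" using j eq by blast
      then have "u i \<in> vec.span (u ` ({..<k} - {i}))" by (rule vec.span_base)
      then show False using not_in_span i by simp
    qed
  qed
  have "vec.independent (u ` {..<k})"
    unfolding vec.dependent_def
  proof
    assume "\<exists>a\<in>u ` {..<k}. a \<in> vec.span (u ` {..<k} - {a})"
    then obtain i where i: "i < k" and "u i \<in> vec.span (u ` {..<k} - {u i})" by blast
    moreover have "u ` {..<k} - {u i} = u ` ({..<k} - {i})"
      using inj_on_image_set_diff[OF inj, of "{..<k}" "{i}"] i by simp
    ultimately show False using not_in_span by simp
  qed
  then have "card (u ` {..<k}) \<le> vec.dim U"
    using in_U by (intro vec.independent_card_le_dim) auto
  then show ?thesis using card_image[OF inj] by simp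
qed

lemma obtain_inj_enumeration:
  assumes "finite A" "k \<le> card A"
  obtains h :: "nat \<Rightarrow> 'b" where "inj_on h {..<k}" "h ` {..<k} \<subseteq> A"
  using card_le_inj[of "{..<k}" A] assms by auto

definition level_restrict :: "('n \<Rightarrow> nat) \<Rightarrow> nat \<Rightarrow> 'a::zero^'n \<Rightarrow> 'a^'n" where
  "level_restrict lev t v = (\<chi> p. if lev p = t then v $ p else 0)"

lemma mult_level_restrict:
  fixes y :: "'a::semiring_1^'n::finite^'m"
  assumes y: "\<forall>p q. y $ p $ q \<noteq> 0 \<longrightarrow> t \<le> lev q" and v: "\<forall>p. v $ p \<noteq> 0 \<longrightarrow> lev p \<le> t"
  shows "y *v level_restrict lev t v = y *v v"
proof -
  have "y $ i $ j * level_restrict lev t v $ j = y $ i $ j * v $ j" for i j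
  proof (cases "lev j = t")
    case False
    then have "y $ i $ j = 0 \<or> v $ j = 0" using y v by (meson le_antisym)
    then show ?thesis using False by (auto simp: level_restrict_def)
  qed (simp add: level_restrict_def)
  then show ?thesis by (simp add: matrix_vector_mult_def)
qed

context levels
begin

lemma lann_complement_cols_ge:
  assumes "t \<le> r" "y \<in> lann (coord_phi lev) (**) 0 (r - t + 1)" "y $ p $ q \<noteq> (0::'a::semiring_1)"
  shows "t \<le> lev q"
proof -
  have "r - (r - t + 1) < lev q" using assms(2,3) unfolding lann_coord_phi by blast
  then show ?thesis using assms(1) by linarith
qed

lemma biorthogonal_system_card_le:
  fixes x y :: "nat \<Rightarrow> 'a::field^'n^'n"
  assumes t: "t \<le> r"
    and mem: "\<And>i. i < k \<Longrightarrow>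
      x i \<in> rann (coord_phi lev) (**) 0 t \<and> y i \<in> lann (coord_phi lev) (**) 0 (r - t + 1)"
    and orth: "\<And>i j. i < k \<Longrightarrow> j < k \<Longrightarrow> y i ** x j = 0 \<longleftrightarrow> i \<noteq> j"
  shows "k \<le> card {p. lev p = t}"
proof -
  have x_rows: "\<forall>p q. x i $ p $ q \<noteq> 0 \<longrightarrow> lev p \<le> t" if "i < k" for i
    using mem[OF that] unfolding rann_coord_phi by blast
  have y_cols: "\<forall>p q. y i $ p $ q \<noteq> 0 \<longrightarrow> t \<le> lev q" if "i < k" for i
    using mem[OF that] t by (intro allI impI lann_complement_cols_ge) auto
  have "\<exists>q. column q (y i ** x i) \<noteq> 0" if "i < k" for i
    using orth[OF that that] by (auto simp: matrix_eq_iff_columns)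
  then obtain col where col: "column (col i) (y i ** x i) \<noteq> 0" if "i < k" for i
    by metis
  define u where "u i = level_restrict lev t (column (col i) (x i))" for i
  have y_u: "y j *v u i = column (col i) (y j ** x i)" if "i < k" "j < k" for i j
  proof -
    have "\<forall>p. column (col i) (x i) $ p \<noteq> 0 \<longrightarrow> lev p \<le> t"
      using x_rows[OF that(1)] by (auto simp: column_def)
    then show ?thesis
      unfolding u_def column_matrix_mult by (rule mult_level_restrict[OF y_cols[OF that(2)]])
  qed
  have "u i \<notin> vec.span (u ` ({..<k} - {i}))" if i: "i < k" for i
  proof
    assume "u i \<in> vec.span (u ` ({..<k} - {i}))"
    moreover have "y i *v u j = 0" if "j < k" "j \<noteq> i" for j
      using y_u[OF that(1) i] orth[OF i that(1)] that(2) by simp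
    then have "vec.span (u ` ({..<k} - {i})) \<subseteq> {v. y i *v v = 0}"
      by (intro vec.span_minimal vec.subspace_kernel) auto
    ultimately show False using col[OF i] y_u[OF i i] by auto
  qed
  moreover have "u i \<in> {w. \<forall>p. p \<notin> {p. lev p = t} \<longrightarrow> w $ p = 0}" for i
    by (simp add: u_def level_restrict_def)
  ultimately have "k \<le> vec.dim {w::'a^'n. \<forall>p. p \<notin> {p. lev p = t} \<longrightarrow> w $ p = 0}"
    by (intro card_le_dim_if_not_in_span_others)
  then show ?thesis by (simp only: dim_substandard_cart)
qed

lemma biorthogonal_system_exists:
  assumes t: "1 < t" "t < r" and k: "k \<le> card {p. lev p = t}"
  shows "has_biorthogonal_system (**) (0::'a::field^'n^'n)
     (rann (coord_phi lev) (**) 0 t) (lann (coord_phi lev) (**) 0 (r - t + 1)) k"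
proof -
  obtain h where h: "inj_on h {..<k}" "h ` {..<k} \<subseteq> {p. lev p = t}"
    using obtain_inj_enumeration[OF finite k] .
  obtain first where first: "lev first = 1" using lev_surj[of 1] t by auto
  obtain last where last: "lev last = r" using lev_surj[of r] t by auto
  define x where "x i = (col_mat last (axis (h i) 1) :: 'a^'n^'n)" for i
  define y where "y i = (col_mat (h i) (axis first 1) :: 'a^'n^'n)" for i
  have "x i \<in> rann (coord_phi lev) (**) 0 t" if "i < k" for i
  proof -
    have ht: "lev (h i) = t" using h that by blast
    have "x i \<in> coord_phi lev" unfolding x_def using ht t last by (intro col_mat_axis_in_coord_phi) simp
    moreover have "lev p \<le> t" if "x i $ p $ q \<noteq> 0" for p q
      using that ht by (simp add: x_def axis_def split: if_splits)
    ultimately show ?thesis unfolding rann_coord_phi by blast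
  qed
  moreover have "y i \<in> lann (coord_phi lev) (**) 0 (r - t + 1)" if "i < k" for i
  proof -
    have ht: "lev (h i) = t" using h that by blast
    have "y i \<in> coord_phi lev" unfolding y_def using ht t first by (intro col_mat_axis_in_coord_phi) simp
    moreover have "r - (r - t + 1) < lev q" if "y i $ p $ q \<noteq> 0" for p q
      using that ht t by (simp add: y_def split: if_splits)
    ultimately show ?thesis unfolding lann_coord_phi by blast
  qed
  moreover have "y i ** x j = 0 \<longleftrightarrow> i \<noteq> j" if "i < k" "j < k" for i j
  proof -
    have "axis first (1::'a) \<noteq> 0" by simp
    then show ?thesis
      using h that by (simp add: x_def y_def col_mat_mult_col_mat axis_def inj_on_eq_iff)
  qed
  ultimately show ?thesis
    unfolding has_biorthogonal_system_def by (intro exI[of _ x] exI[of _ y]) auto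
qed

lemma has_biorthogonal_system_iff_card:
  assumes "1 < t" "t < r"
  shows "has_biorthogonal_system (**) (0::'a::field^'n^'n)
     (rann (coord_phi lev) (**) 0 t) (lann (coord_phi lev) (**) 0 (r - t + 1)) k
     \<longleftrightarrow> k \<le> card {p. lev p = t}"
proof
  assume "has_biorthogonal_system (**) (0::'a::field^'n^'n)
     (rann (coord_phi lev) (**) 0 t) (lann (coord_phi lev) (**) 0 (r - t + 1)) k"
  then obtain x y :: "nat \<Rightarrow> 'a^'n^'n" where
    "\<forall>i<k. x i \<in> rann (coord_phi lev) (**) 0 t \<and> y i \<in> lann (coord_phi lev) (**) 0 (r - t + 1)"
    "\<forall>i<k. \<forall>j<k. y i ** x j = 0 \<longleftrightarrow> i \<noteq> j"
    unfolding has_biorthogonal_system_def by blast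
  with assms show "k \<le> card {p. lev p = t}" by (intro biorthogonal_system_card_le) auto
qed (rule biorthogonal_system_exists[OF assms])

end

section \<open>The projective geometry of the bottom level\<close>

lemma subspace_of_line:
  fixes a :: "'a::field^'n::finite"
  assumes "vec.subspace U" "U \<subseteq> vec.span {a}"
  shows "U = {0} \<or> U = vec.span {a}"
proof (cases "U \<subseteq> {0}")
  case True
  then show ?thesis using vec.subspace_0[OF assms(1)] by blast
next
  case False
  then obtain b where b: "b \<in> U" "b \<noteq> 0" by blast
  then obtain c where c: "b = c *s a" using assms(2) vec.span_singleton by blast
  then have "c \<noteq> 0" using b(2) by auto
  then have "a = inverse c *s b" using c by simp
  then have "a \<in> U" using vec.subspace_scale[OF assms(1) b(1)] by simp
  then have "vec.span {a} \<subseteq> U" using assms(1) by (simp add: vec.span_minimal)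
  then show ?thesis using assms(2) by blast
qed

lemma span_singleton_eq_0_iff: "vec.span {a} = {0} \<longleftrightarrow> (a :: 'a::field^'n::finite) = 0"
  using vec.span_base[of a "{a}"] by auto

lemma span_pair_eq: "vec.span {b, b'} = {c *s b + c' *s b' |c c'. True}"
  by (auto simp: vec.span_insert vec.span_singleton algebra_simps; metis add_diff_cancel)

context levels
begin

lemma one_le_r: "1 \<le> r"
  using lev_pos lev_le order_trans by blast

lemma coord_phi_iff_columns:
  "a \<in> coord_phi lev \<longleftrightarrow> (\<forall>q. column q a \<in> coord_flag lev (lev q - 1))"
proof -
  have "lev p < lev q \<longleftrightarrow> lev p \<le> lev q - 1" for p q using lev_pos[of q] by linarith
  then show ?thesis by (auto simp: coord_phi_def coord_flag_def column_def)
qed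

definition image_below_top :: "'a::semiring_1^'n^'n \<Rightarrow> ('a^'n) set" where
  "image_below_top x = (\<lambda>v. x *v v) ` coord_flag lev (r - 1)"

lemma subspace_image_below_top: "vec.subspace (image_below_top (x :: 'a::field^'n^'n))"
  unfolding image_below_top_def by (intro vec.subspace_image subspace_coord_flag)

lemma image_below_top_zero: "image_below_top 0 = {0}"
  unfolding image_below_top_def by (auto simp: coord_flag_def intro!: image_eqI[of _ _ 0])

lemma image_below_top_rows:
  assumes "\<forall>p q. x $ p $ q \<noteq> 0 \<longrightarrow> lev p \<le> j"
  shows "image_below_top x \<subseteq> coord_flag lev j"
proof
  fix u assume "u \<in> image_below_top x"
  then obtain v where u: "u = x *v v" unfolding image_below_top_def by blast
  show "u \<in> coord_flag lev j" unfolding coord_flag_def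
  proof (intro CollectI allI impI)
    fix p assume "u $ p \<noteq> 0"
    then obtain k where "x $ p $ k \<noteq> 0" unfolding u by (rule matrix_vector_mult_nonzero_entry)
    then show "lev p \<le> j" using assms by blast
  qed
qed

lemma corner_coord_phi:
  "x \<in> corner (coord_phi lev) (**) 0 \<longleftrightarrow> x \<in> coord_phi lev \<and>
     (\<forall>p q. x $ p $ q \<noteq> 0 \<longrightarrow> lev p \<le> 1) \<and> (\<forall>p q. x $ p $ q \<noteq> 0 \<longrightarrow> r - 2 < lev q)"
  unfolding corner_def rann_coord_phi lann_coord_phi by blast

lemma right_ideal_subset_imp_image_subset:
  assumes "right_ideal (coord_phi lev) (**) x \<subseteq> right_ideal (coord_phi lev) (**) w"
  shows "image_below_top x \<subseteq> image_below_top (w :: 'a::field^'n^'n)"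
proof
  fix u assume "u \<in> image_below_top x"
  then obtain v where v: "v \<in> coord_flag lev (r - 1)" "u = x *v v"
    unfolding image_below_top_def by blast
  obtain top where top: "lev top = r" using lev_surj[of r] one_le_r by blast
  have "lev p < lev top" if "v $ p \<noteq> 0" for p
  proof -
    have "lev p \<le> r - 1" using v(1) that unfolding coord_flag_def by blast
    then show ?thesis using top one_le_r by linarith
  qed
  then have "col_mat top v \<in> coord_phi lev" by (simp add: col_mat_in_coord_phi_iff)
  then have "x ** col_mat top v \<in> right_ideal (coord_phi lev) (**) w"
    using assms unfolding right_ideal_def by blast
  then obtain s where s: "s \<in> coord_phi lev" "x ** col_mat top v = w ** s"
    unfolding right_ideal_def by blast
  have "u = column top (w ** s)"
    using s(2) v(2) by (metis column_col_mat column_matrix_mult)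
  also have "\<dots> = w *v column top s" by (rule column_matrix_mult)
  finally show "u \<in> image_below_top w"
    using s(1) top unfolding image_below_top_def coord_phi_iff_columns by blast
qed

lemma top_columns_mult_column_eq_zero:
  assumes x: "\<forall>p q. x $ p $ q \<noteq> 0 \<longrightarrow> r - 2 < lev q"
    and s: "s \<in> coord_phi lev" and q: "lev q < r"
  shows "x *v column q s = (0 :: 'a::semiring_1^'n)"
proof (rule ccontr)
  assume "x *v column q s \<noteq> 0"
  then obtain p where "(x *v column q s) $ p \<noteq> 0" by (metis vec_eq_iff zero_index)
  then obtain k where "x $ p $ k \<noteq> 0" "column q s $ k \<noteq> 0"
    by (rule matrix_vector_mult_nonzero_entry)
  then have "r - 2 < lev k" "lev k < lev q"
    using x s by (auto simp: coord_phi_def column_def)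
  then show False using q by linarith
qed

lemma image_subset_imp_right_ideal_subset:
  assumes x: "\<forall>p q. x $ p $ q \<noteq> 0 \<longrightarrow> r - 2 < lev q"
    and sub: "image_below_top x \<subseteq> image_below_top (w :: 'a::field^'n^'n)"
  shows "right_ideal (coord_phi lev) (**) x \<subseteq> right_ideal (coord_phi lev) (**) w"
proof
  fix m assume "m \<in> right_ideal (coord_phi lev) (**) x"
  then obtain s where s: "s \<in> coord_phi lev" "m = x ** s" unfolding right_ideal_def by blast
  have "\<exists>c. c \<in> coord_flag lev (lev q - 1) \<and> w *v c = column q m" for q
  proof (cases "lev q = r")
    case True
    have "column q s \<in> coord_flag lev (r - 1)" using s(1) True unfolding coord_phi_iff_columns by metis
    then have "column q m \<in> image_below_top x"
      unfolding image_below_top_def s(2) column_matrix_mult by (rule imageI)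
    then obtain c where "c \<in> coord_flag lev (r - 1)" "column q m = w *v c"
      using sub unfolding image_below_top_def by blast
    then show ?thesis using True by auto
  next
    case False
    then have "x *v column q s = 0"
      using x s(1) lev_le[of q] by (intro top_columns_mult_column_eq_zero) simp_all
    then show ?thesis
      using s(2) by (intro exI[of _ 0]) (simp add: coord_flag_def column_matrix_mult)
  qed
  then obtain c where c: "c q \<in> coord_flag lev (lev q - 1)" "w *v c q = column q m" for q
    by metis
  define s' :: "'a^'n^'n" where "s' = (\<chi> i j. c j $ i)"
  have column_s': "column q s' = c q" for q by (simp add: s'_def column_def vec_eq_iff)
  have "s' \<in> coord_phi lev" using c(1) by (simp add: coord_phi_iff_columns column_s')
  moreover have "w ** s' = m"
    by (simp add: matrix_eq_iff_columns column_matrix_mult column_s' c(2))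
  ultimately show "m \<in> right_ideal (coord_phi lev) (**) w" unfolding right_ideal_def by blast
qed

lemma right_ideal_subset_iff_image:
  assumes "x \<in> corner (coord_phi lev) (**) 0" "w \<in> coord_phi lev"
  shows "right_ideal (coord_phi lev) (**) x \<subseteq> right_ideal (coord_phi lev) (**) w \<longleftrightarrow>
    image_below_top x \<subseteq> image_below_top (w :: 'a::field^'n^'n)"
  using assms right_ideal_subset_imp_image_subset image_subset_imp_right_ideal_subset
  unfolding corner_coord_phi by blast

lemma zero_in_corner: "0 \<in> corner (coord_phi lev) (**) (0::'a::semiring_1^'n^'n)"
  by (simp add: corner_coord_phi zero_in_coord_phi)

lemma corner_image_subset_level_one:
  assumes "x \<in> corner (coord_phi lev) (**) 0"
  shows "image_below_top x \<subseteq> coord_flag lev 1"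
  using assms unfolding corner_coord_phi by (intro image_below_top_rows) blast

lemma corner_right_ideal_subset_iff:
  assumes "y \<in> corner (coord_phi lev) (**) 0" "x \<in> corner (coord_phi lev) (**) 0"
  shows "right_ideal (coord_phi lev) (**) y \<subseteq> right_ideal (coord_phi lev) (**) x \<longleftrightarrow>
    image_below_top y \<subseteq> image_below_top (x :: 'a::field^'n^'n)"
  using assms(2) by (intro right_ideal_subset_iff_image[OF assms(1)]) (simp add: corner_coord_phi)

lemma corner_right_ideal_eq_iff:
  assumes "y \<in> corner (coord_phi lev) (**) 0" "x \<in> corner (coord_phi lev) (**) 0"
  shows "right_ideal (coord_phi lev) (**) y = right_ideal (coord_phi lev) (**) x \<longleftrightarrow>
    image_below_top y = image_below_top (x :: 'a::field^'n^'n)"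
  by (simp only: set_eq_subset corner_right_ideal_subset_iff[OF assms]
      corner_right_ideal_subset_iff[OF assms(2,1)])

lemma points_coord_phi:
  "x \<in> points (coord_phi lev) (**) (0::'a::field^'n^'n) \<longleftrightarrow> x \<in> corner (coord_phi lev) (**) 0 \<and>
     image_below_top x \<noteq> {0} \<and> (\<forall>y\<in>corner (coord_phi lev) (**) 0.
       image_below_top y \<subseteq> image_below_top x \<longrightarrow> image_below_top y = {0} \<or> image_below_top y = image_below_top x)"
proof (cases "x \<in> corner (coord_phi lev) (**) 0")
  case True
  let ?R = "right_ideal (coord_phi lev) (**)"
  have minimal_iff:
    "(?R y \<subseteq> ?R x \<longrightarrow> ?R y = ?R 0 \<or> ?R y = ?R x) \<longleftrightarrow>
     (image_below_top y \<subseteq> image_below_top x \<longrightarrow>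
        image_below_top y = {0} \<or> image_below_top y = image_below_top x)"
    if y: "y \<in> corner (coord_phi lev) (**) 0" for y
    by (simp add: corner_right_ideal_subset_iff[OF y True] corner_right_ideal_eq_iff[OF y True]
        corner_right_ideal_eq_iff[OF y zero_in_corner] image_below_top_zero)
  have "?R x \<noteq> ?R 0 \<longleftrightarrow> image_below_top x \<noteq> {0}"
    by (simp add: corner_right_ideal_eq_iff[OF True zero_in_corner] image_below_top_zero)
  with True show ?thesis
    unfolding points_def mem_Collect_eq using minimal_iff by (simp cong: ball_cong)
qed (simp add: points_def)

lemma coord_flag_one_eq: "coord_flag lev 1 = {w. \<forall>p. p \<notin> {p. lev p = 1} \<longrightarrow> w $ p = 0}"
proof -
  have "lev p \<le> 1 \<longleftrightarrow> lev p = 1" for p using lev_pos[of p] by linarith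
  then show ?thesis by (auto simp: coord_flag_def)
qed

end

locale levels_ge4 = levels lev r for lev :: "'n::finite \<Rightarrow> nat" and r +
  assumes four_le_r: "4 \<le> r"
begin

lemma obtain_corner_with_line_image:
  assumes a: "a \<in> coord_flag lev 1"
  obtains x :: "'a::field^'n^'n" where "x \<in> corner (coord_phi lev) (**) 0" "image_below_top x = vec.span {a}"
proof -
  have "1 \<le> r - 1" "r - 1 \<le> r" using four_le_r by simp_all
  then obtain q where q: "lev q = r - 1" by (rule obtain_level)
  have corner: "col_mat q a \<in> corner (coord_phi lev) (**) 0"
    unfolding corner_coord_phi using a q four_le_r by (auto simp: coord_phi_def coord_flag_def)
  have "image_below_top (col_mat q a) = (\<lambda>v. v $ q *s a) ` coord_flag lev (r - 1)"
    by (simp add: image_below_top_def col_mat_mult_vec)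
  also have "\<dots> = range (\<lambda>c. c *s a)"
  proof (intro equalityI subsetI)
    fix u assume "u \<in> range (\<lambda>c. c *s a)"
    then obtain c where u: "u = c *s a" by blast
    have "axis q c \<in> coord_flag lev (r - 1)" using q by (simp add: coord_flag_def axis_def)
    then show "u \<in> (\<lambda>v. v $ q *s a) ` coord_flag lev (r - 1)" unfolding u by (rule image_eqI[rotated]) simp
  qed auto
  finally have "image_below_top (col_mat q a) = vec.span {a}" by (simp add: vec.span_singleton)
  with corner show ?thesis by (rule that)
qed

lemma obtain_rann_one_with_plane_image:
  assumes b: "b \<in> coord_flag lev 1" and b': "b' \<in> coord_flag lev 1"
  obtains w :: "'a::field^'n^'n"
  where "w \<in> rann (coord_phi lev) (**) 0 1" "image_below_top w = vec.span {b, b'}"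
proof -
  have "1 \<le> (2::nat)" "2 \<le> r" using four_le_r by simp_all
  then obtain p2 where p2: "lev p2 = 2" by (rule obtain_level)
  have "1 \<le> (3::nat)" "3 \<le> r" using four_le_r by simp_all
  then obtain p3 where p3: "lev p3 = 3" by (rule obtain_level)
  define w where "w = col_mat p2 b + col_mat p3 b'"
  have w_nz: "lev i \<le> 1 \<and> 1 < lev j" if "w $ i $ j \<noteq> 0" for i j
  proof -
    have "(j = p2 \<and> b $ i \<noteq> 0) \<or> (j = p3 \<and> b' $ i \<noteq> 0)"
      using that by (auto simp: w_def split: if_splits)
    then show ?thesis using b b' p2 p3 unfolding coord_flag_def by auto
  qed
  then have "w \<in> rann (coord_phi lev) (**) 0 1"
    unfolding rann_coord_phi by (fastforce simp: coord_phi_def)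
  moreover have "image_below_top w = vec.span {b, b'}"
  proof -
    have w_mult: "w *v v = v $ p2 *s b + v $ p3 *s b'" for v
      by (simp add: w_def matrix_vector_mult_add_rdistrib col_mat_mult_vec)
    have "c *s b + c' *s b' \<in> image_below_top w" for c c'
    proof -
      have "axis p2 c + axis p3 c' \<in> coord_flag lev (r - 1)"
        using p2 p3 four_le_r by (auto simp: coord_flag_def axis_def)
      moreover have "w *v (axis p2 c + axis p3 c') = c *s b + c' *s b'"
        using p2 p3 by (auto simp: w_mult axis_def)
      ultimately show ?thesis unfolding image_below_top_def by (metis image_eqI)
    qed
    moreover have "w *v v \<in> vec.span {b, b'}" for v
      unfolding w_mult span_pair_eq by blast
    ultimately show ?thesis unfolding span_pair_eq image_below_top_def by blast
  qed
  ultimately show ?thesis by (rule that)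
qed

lemma points_iff_line:
  "x \<in> points (coord_phi lev) (**) (0::'a::field^'n^'n) \<longleftrightarrow>
     x \<in> corner (coord_phi lev) (**) 0 \<and> (\<exists>a. a \<noteq> 0 \<and> image_below_top x = vec.span {a})"
proof
  assume x: "x \<in> points (coord_phi lev) (**) 0"
  then have corner: "x \<in> corner (coord_phi lev) (**) 0" and nonzero: "image_below_top x \<noteq> {0}"
    by (simp_all add: points_coord_phi)
  obtain a where a: "a \<in> image_below_top x" "a \<noteq> 0"
    using nonzero vec.subspace_0[OF subspace_image_below_top] by blast
  have "a \<in> coord_flag lev 1" using a(1) corner_image_subset_level_one[OF corner] by blast
  then obtain y where y: "y \<in> corner (coord_phi lev) (**) 0" "image_below_top y = vec.span {a}"
    by (rule obtain_corner_with_line_image)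
  have "vec.span {a} \<subseteq> image_below_top x"
    using a(1) by (simp add: vec.span_minimal subspace_image_below_top)
  moreover have "\<forall>z\<in>corner (coord_phi lev) (**) 0. image_below_top z \<subseteq> image_below_top x \<longrightarrow>
      image_below_top z = {0} \<or> image_below_top z = image_below_top x"
    using x by (simp add: points_coord_phi)
  ultimately have "image_below_top y = {0} \<or> image_below_top y = image_below_top x"
    using y by blast
  then have "image_below_top x = vec.span {a}"
    using y(2) a(2) by (simp add: span_singleton_eq_0_iff)
  with corner a(2) show "x \<in> corner (coord_phi lev) (**) 0 \<and> (\<exists>a. a \<noteq> 0 \<and> image_below_top x = vec.span {a})"
    by blast
next
  assume "x \<in> corner (coord_phi lev) (**) 0 \<and> (\<exists>a. a \<noteq> 0 \<and> image_below_top x = vec.span {a})"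
  then obtain a where x: "x \<in> corner (coord_phi lev) (**) 0" "a \<noteq> 0" "image_below_top x = vec.span {a}"
    by blast
  moreover have "\<forall>y\<in>corner (coord_phi lev) (**) 0. image_below_top y \<subseteq> image_below_top x \<longrightarrow>
      image_below_top y = {0} \<or> image_below_top y = image_below_top x"
    using subspace_of_line[OF subspace_image_below_top] x(3) by blast
  ultimately show "x \<in> points (coord_phi lev) (**) 0"
    by (simp add: points_coord_phi span_singleton_eq_0_iff)
qed

lemma obtain_point_with_line_image:
  assumes "a \<in> coord_flag lev 1" "a \<noteq> 0"
  obtains x :: "'a::field^'n^'n"
  where "x \<in> points (coord_phi lev) (**) 0" "image_below_top x = vec.span {a}"
proof -
  obtain x :: "'a^'n^'n" where "x \<in> corner (coord_phi lev) (**) 0" "image_below_top x = vec.span {a}"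
    using assms(1) by (rule obtain_corner_with_line_image)
  then show ?thesis using that assms(2) points_iff_line by blast
qed

lemma on_line_imp_image_subset_span:
  assumes y: "y \<in> corner (coord_phi lev) (**) 0" "image_below_top y = vec.span {b}"
    and y': "y' \<in> corner (coord_phi lev) (**) 0" "image_below_top y' = vec.span {b'}"
    and line: "on_line (coord_phi lev) (**) (0::'a::field^'n^'n) y y' x"
  shows "image_below_top x \<subseteq> vec.span {b, b'}"
proof -
  have x: "x \<in> corner (coord_phi lev) (**) 0" using line by (simp add: on_line_def points_def)
  have "b \<in> coord_flag lev 1" "b' \<in> coord_flag lev 1"
    using corner_image_subset_level_one[OF y(1)] corner_image_subset_level_one[OF y'(1)] y(2) y'(2)
    by (auto intro: vec.span_base)
  then obtain w where w: "w \<in> rann (coord_phi lev) (**) 0 1" "image_below_top w = vec.span {b, b'}"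
    by (rule obtain_rann_one_with_plane_image)
  have w_phi: "w \<in> coord_phi lev" using w(1) rann_coord_phi_subset by blast
  have "vec.span {b} \<subseteq> vec.span {b, b'}" "vec.span {b'} \<subseteq> vec.span {b, b'}"
    by (simp_all add: vec.span_mono)
  then have "right_ideal (coord_phi lev) (**) y \<subseteq> right_ideal (coord_phi lev) (**) w"
    "right_ideal (coord_phi lev) (**) y' \<subseteq> right_ideal (coord_phi lev) (**) w"
    using right_ideal_subset_iff_image[OF y(1) w_phi] right_ideal_subset_iff_image[OF y'(1) w_phi]
      y(2) y'(2) w(2)
    by simp_all
  then have "right_ideal (coord_phi lev) (**) x \<subseteq> right_ideal (coord_phi lev) (**) w"
    using line w(1) by (simp add: on_line_def del: rann.simps)
  then show ?thesis using right_ideal_subset_iff_image[OF x w_phi] w(2) by simp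
qed

lemma on_line_if_image_subset_span:
  assumes y: "y \<in> corner (coord_phi lev) (**) 0" "image_below_top y = vec.span {b}"
    and y': "y' \<in> corner (coord_phi lev) (**) 0" "image_below_top y' = vec.span {b'}"
    and x: "x \<in> points (coord_phi lev) (**) (0::'a::field^'n^'n)" "image_below_top x \<subseteq> vec.span {b, b'}"
  shows "on_line (coord_phi lev) (**) 0 y y' x"
proof -
  have x_corner: "x \<in> corner (coord_phi lev) (**) 0" using x(1) by (simp add: points_def)
  have "right_ideal (coord_phi lev) (**) x \<subseteq> right_ideal (coord_phi lev) (**) w"
    if w: "w \<in> rann (coord_phi lev) (**) 0 1"
      and "right_ideal (coord_phi lev) (**) y \<subseteq> right_ideal (coord_phi lev) (**) w"
      and "right_ideal (coord_phi lev) (**) y' \<subseteq> right_ideal (coord_phi lev) (**) w" for w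
  proof -
    have w_phi: "w \<in> coord_phi lev" using w rann_coord_phi_subset by blast
    have "vec.span {b} \<subseteq> image_below_top w" "vec.span {b'} \<subseteq> image_below_top w"
      using that right_ideal_subset_iff_image[OF y(1) w_phi] right_ideal_subset_iff_image[OF y'(1) w_phi]
        y(2) y'(2)
      by simp_all
    then have "vec.span {b, b'} \<subseteq> image_below_top w"
      by (intro vec.span_minimal subspace_image_below_top) (auto intro: vec.span_base)
    then show ?thesis using x(2) right_ideal_subset_iff_image[OF x_corner w_phi] by blast
  qed
  then show ?thesis using x(1) by (simp add: on_line_def del: rann.simps)
qed

lemma point_closure_image_subset_span:
  assumes G: "G \<subseteq> points (coord_phi lev) (**) (0::'a::field^'n^'n)"
    and x: "x \<in> point_closure (coord_phi lev) (**) 0 G"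
  shows "image_below_top x \<subseteq> vec.span (\<Union> (image_below_top ` G))"
  using x
proof (induction rule: point_closure.induct)
  case (generator x)
  then show ?case by (auto intro: vec.span_base)
next
  case (line y y' x)
  have "y \<in> points (coord_phi lev) (**) 0" "y' \<in> points (coord_phi lev) (**) 0"
    using line.hyps(1,2) point_closure_subset_points[of "coord_phi lev" "(**)" 0 G] by auto
  then obtain b b' where y: "y \<in> corner (coord_phi lev) (**) 0" "image_below_top y = vec.span {b}"
    and y': "y' \<in> corner (coord_phi lev) (**) 0" "image_below_top y' = vec.span {b'}"
    using points_iff_line by meson
  have "b \<in> vec.span (\<Union> (image_below_top ` G))" "b' \<in> vec.span (\<Union> (image_below_top ` G))"
    using line.IH y(2) y'(2) by (auto intro: vec.span_base)
  then have "vec.span {b, b'} \<subseteq> vec.span (\<Union> (image_below_top ` G))"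
    by (intro vec.span_minimal) (auto simp: vec.subspace_span)
  moreover have "image_below_top x \<subseteq> vec.span {b, b'}"
    using y y' line.hyps(3) by (rule on_line_imp_image_subset_span)
  ultimately show ?case by blast
qed

text \<open>Induction over the span: a point whose line is spanned by \<open>c b + v\<close>, with \<open>b\<close> on a
  generating point \<open>g\<close>, lies on the line through \<open>g\<close> and a point carrying \<open>v\<close>.\<close>
lemma point_in_closure_if_in_span:
  assumes G: "G \<subseteq> points (coord_phi lev) (**) (0::'a::field^'n^'n)"
  shows "v \<in> vec.span (\<Union> (image_below_top ` G)) \<Longrightarrow> v \<noteq> 0 \<Longrightarrow>
    x \<in> points (coord_phi lev) (**) 0 \<Longrightarrow> image_below_top x = vec.span {v} \<Longrightarrow>
    x \<in> point_closure (coord_phi lev) (**) 0 G"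
proof (induction v arbitrary: x rule: vec.span_induct_alt)
  case base
  then show ?case by simp
next
  case (step c b v x)
  obtain g where g: "g \<in> G" "b \<in> image_below_top g" using step.hyps(1) by blast
  have g_point: "g \<in> points (coord_phi lev) (**) 0" using g(1) G by blast
  then have g_corner: "g \<in> corner (coord_phi lev) (**) 0" by (simp add: points_def)
  obtain a where a: "image_below_top g = vec.span {a}" using g_point by (meson points_iff_line)
  have g_closure: "g \<in> point_closure (coord_phi lev) (**) 0 G"
    using g(1) g_point by (rule point_closure.generator)
  have b: "b \<in> vec.span {a}" using g(2) a by simp
  show ?case
  proof (cases "v = 0")
    case True
    have "image_below_top x \<subseteq> vec.span {a, a}"
      using step.prems(3) b True by (simp add: vec.span_minimal vec.span_scale)
    then have "on_line (coord_phi lev) (**) 0 g g x"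
      using on_line_if_image_subset_span[OF g_corner a g_corner a] step.prems(2) by blast
    then show ?thesis by (rule point_closure.line[OF g_closure g_closure])
  next
    case False
    have "c *s b + v \<in> coord_flag lev 1" "b \<in> coord_flag lev 1"
      using corner_image_subset_level_one step.prems(2) g_point g(2) step.prems(3)
      by (auto simp: points_def intro: vec.span_base)
    then have "(c *s b + v) - c *s b \<in> coord_flag lev 1"
      by (intro vec.subspace_diff subspace_coord_flag vec.subspace_scale)
    then have "v \<in> coord_flag lev 1" by simp
    then obtain x' where x'_point: "x' \<in> points (coord_phi lev) (**) 0"
      and x': "image_below_top x' = vec.span {v}"
      using False by (rule obtain_point_with_line_image)
    have x'_closure: "x' \<in> point_closure (coord_phi lev) (**) 0 G"
      by (rule step.IH[OF False x'_point x'])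
    have x'_corner: "x' \<in> corner (coord_phi lev) (**) 0" using x'_point by (simp add: points_def)
    have "c *s b + v \<in> vec.span {v, a}"
      using b by (intro vec.span_add vec.span_scale) (auto intro: vec.span_base vec.span_mono[THEN subsetD])
    then have "image_below_top x \<subseteq> vec.span {v, a}"
      using step.prems(3) by (simp add: vec.span_minimal)
    then have "on_line (coord_phi lev) (**) 0 x' g x"
      using on_line_if_image_subset_span[OF x'_corner x' g_corner a] step.prems(2) by blast
    then show ?thesis by (rule point_closure.line[OF x'_closure g_closure])
  qed
qed

lemma point_closure_iff_span:
  assumes G: "G \<subseteq> points (coord_phi lev) (**) (0::'a::field^'n^'n)"
    and x: "x \<in> points (coord_phi lev) (**) 0"
  shows "x \<in> point_closure (coord_phi lev) (**) 0 G \<longleftrightarrow>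
    image_below_top x \<subseteq> vec.span (\<Union> (image_below_top ` G))"
proof
  assume "image_below_top x \<subseteq> vec.span (\<Union> (image_below_top ` G))"
  moreover obtain a where a: "a \<noteq> 0" "image_below_top x = vec.span {a}"
    using x points_iff_line by blast
  ultimately show "x \<in> point_closure (coord_phi lev) (**) 0 G"
    using point_in_closure_if_in_span[OF G _ a(1) x a(2)] by (auto intro: vec.span_base)
qed (rule point_closure_image_subset_span[OF G])

lemma independent_points_card_le:
  fixes x :: "nat \<Rightarrow> 'a::field^'n^'n"
  assumes points: "\<And>i. i < k \<Longrightarrow> x i \<in> points (coord_phi lev) (**) 0"
    and indep: "\<And>i. i < k \<Longrightarrow> x i \<notin> point_closure (coord_phi lev) (**) 0 (x ` ({..<k} - {i}))"
  shows "k \<le> card {p. lev p = 1}"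
proof -
  have "\<forall>i<k. \<exists>a. image_below_top (x i) = vec.span {a}"
    using points points_iff_line by blast
  then obtain a where a: "\<And>i. i < k \<Longrightarrow> image_below_top (x i) = vec.span {a i}"
    by metis
  have "a i \<in> coord_flag lev 1" if "i < k" for i
    using corner_image_subset_level_one points[OF that] a[OF that]
    by (auto simp: points_def intro: vec.span_base)
  moreover have "a i \<notin> vec.span (a ` ({..<k} - {i}))" if i: "i < k" for i
  proof
    let ?U = "vec.span (\<Union> (image_below_top ` x ` ({..<k} - {i})))"
    assume "a i \<in> vec.span (a ` ({..<k} - {i}))"
    moreover have "a ` ({..<k} - {i}) \<subseteq> ?U"
      using a by (auto intro!: vec.span_base)
    then have "vec.span (a ` ({..<k} - {i})) \<subseteq> ?U"
      by (rule vec.span_minimal[OF _ vec.subspace_span])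
    ultimately have "a i \<in> ?U" by blast
    then have "image_below_top (x i) \<subseteq> ?U"
      unfolding a[OF i] by (rule vec.span_minimal[OF _ vec.subspace_span, of "{a i}", simplified])
    moreover have "x ` ({..<k} - {i}) \<subseteq> points (coord_phi lev) (**) 0" using points by blast
    ultimately have "x i \<in> point_closure (coord_phi lev) (**) 0 (x ` ({..<k} - {i}))"
      using point_closure_iff_span points[OF i] by blast
    then show False using indep i by blast
  qed
  ultimately have "k \<le> vec.dim (coord_flag lev 1 :: ('a^'n) set)"
    by (rule card_le_dim_if_not_in_span_others)
  then show ?thesis unfolding coord_flag_one_eq by (simp only: dim_substandard_cart)
qed

lemma independent_points_exist:
  assumes k: "k \<le> card {p. lev p = 1}"
  shows "has_independent_points (coord_phi lev) (**) (0::'a::field^'n^'n) k"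
proof -
  obtain h where h: "inj_on h {..<k}" "h ` {..<k} \<subseteq> {p. lev p = 1}"
    using obtain_inj_enumeration[OF finite k] .
  have "\<exists>y::'a^'n^'n. y \<in> points (coord_phi lev) (**) 0 \<and> image_below_top y = vec.span {axis (h i) 1}"
    if "i < k" for i
  proof -
    have "axis (h i) (1::'a) \<in> coord_flag lev 1"
      using h that by (auto simp: coord_flag_def axis_def)
    then show ?thesis by (metis obtain_point_with_line_image axis_eq_0_iff zero_neq_one)
  qed
  then obtain x :: "nat \<Rightarrow> 'a^'n^'n" where
    x_points: "\<And>i. i < k \<Longrightarrow> x i \<in> points (coord_phi lev) (**) 0"
    and x_image: "\<And>i. i < k \<Longrightarrow> image_below_top (x i) = vec.span {axis (h i) 1}"
    by metis
  have "x i \<notin> point_closure (coord_phi lev) (**) 0 (x ` ({..<k} - {i}))" if i: "i < k" for i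
  proof
    assume "x i \<in> point_closure (coord_phi lev) (**) 0 (x ` ({..<k} - {i}))"
    moreover have "x ` ({..<k} - {i}) \<subseteq> points (coord_phi lev) (**) 0" using x_points by blast
    ultimately have "image_below_top (x i) \<subseteq> vec.span (\<Union> (image_below_top ` x ` ({..<k} - {i})))"
      using point_closure_iff_span x_points[OF i] by blast
    also have "\<dots> \<subseteq> {w. w $ h i = 0}"
    proof (rule vec.span_minimal)
      show "\<Union> (image_below_top ` x ` ({..<k} - {i})) \<subseteq> {w. w $ h i = 0}"
      proof
        fix w assume "w \<in> \<Union> (image_below_top ` x ` ({..<k} - {i}))"
        then obtain j where j: "j < k" "j \<noteq> i" "w \<in> image_below_top (x j)" by blast
        then obtain c where "w = c *s axis (h j) 1" using x_image vec.span_singleton by blast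
        moreover have "h j \<noteq> h i" using h(1) i j by (auto simp: inj_on_eq_iff)
        ultimately show "w \<in> {w. w $ h i = 0}" by (simp add: axis_def)
      qed
      show "vec.subspace {w :: 'a^'n. w $ h i = 0}" by (auto simp: vec.subspace_def)
    qed
    finally have "axis (h i) (1::'a) $ h i = 0"
      using x_image[OF i] vec.span_base[of "axis (h i) (1::'a)" "{axis (h i) 1}"] by blast
    then show False by simp
  qed
  then show ?thesis unfolding has_independent_points_def using x_points by blast
qed

lemma has_independent_points_iff_card:
  "has_independent_points (coord_phi lev) (**) (0::'a::field^'n^'n) k \<longleftrightarrow> k \<le> card {p. lev p = 1}"
proof
  assume "has_independent_points (coord_phi lev) (**) (0::'a::field^'n^'n) k"
  then obtain x :: "nat \<Rightarrow> 'a^'n^'n" where "\<forall>i<k. x i \<in> points (coord_phi lev) (**) 0"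
    "\<forall>i<k. x i \<notin> point_closure (coord_phi lev) (**) 0 (x ` ({..<k} - {i}))"
    unfolding has_independent_points_def by blast
  then show "k \<le> card {p. lev p = 1}" by (intro independent_points_card_le) auto
qed (rule independent_points_exist)

end

section \<open>Level counts are a complete isomorphism invariant\<close>

lemma zero_semigroup_iso_coord_phi:
  assumes "semigroup_iso_betw (coord_phi l1) (coord_phi l2) (f :: 'a::semiring_1^'n::finite^'n \<Rightarrow> 'a^'m::finite^'m)"
  shows "zero_semigroup_iso (coord_phi l1) (**) 0 (coord_phi l2) (**) 0 f"
proof -
  interpret dom: zero_semigroup "coord_phi l1" "(**)" "0::'a^'n^'n" by (rule zero_semigroup_coord_phi)
  interpret cod: zero_semigroup "coord_phi l2" "(**)" "0::'a^'m^'m" by (rule zero_semigroup_coord_phi)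
  show ?thesis using assms by unfold_locales (auto simp: semigroup_iso_betw_def)
qed

lemma (in levels) levels_reverse: "levels (\<lambda>p. r + 1 - lev p) r"
proof
  fix p
  show "1 \<le> r + 1 - lev p" using lev_le[of p] by simp
  show "r + 1 - lev p \<le> r" using lev_pos[of p] by simp
next
  fix i assume i: "1 \<le> i" "i \<le> r"
  then have "1 \<le> r + 1 - i" "r + 1 - i \<le> r" by simp_all
  then obtain p where "lev p = r + 1 - i" by (rule obtain_level)
  then show "\<exists>p. r + 1 - lev p = i" using i by (intro exI[of _ p]) simp
qed

lemma (in levels_ge4) levels_ge4_reverse: "levels_ge4 (\<lambda>p. r + 1 - lev p) r"
  by (intro levels_ge4.intro levels_reverse levels_ge4_axioms.intro four_le_r)

lemma (in levels) transpose_in_coord_phi_reverse_iff: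
  "transpose a \<in> coord_phi (\<lambda>p. r + 1 - lev p) \<longleftrightarrow> a \<in> coord_phi lev"
proof -
  have "r + 1 - lev p < r + 1 - lev q \<longleftrightarrow> lev q < lev p" for p q
    using lev_le[of p] lev_le[of q] by linarith
  then show ?thesis by (auto simp: coord_phi_def transpose_def)
qed

lemma (in levels) bij_betw_transpose_coord_phi:
  "bij_betw transpose (coord_phi lev) (coord_phi (\<lambda>p. r + 1 - lev p) :: ('a::zero^'n^'n) set)"
  "bij_betw transpose (coord_phi (\<lambda>p. r + 1 - lev p)) (coord_phi lev :: ('a::zero^'n^'n) set)"
  by (rule bij_betw_byWitness[where f' = transpose];
      force simp: transpose_in_coord_phi_reverse_iff[symmetric])+

lemma semigroup_iso_betw_transpose:
  fixes f :: "'a::comm_semiring_1^'n::finite^'n \<Rightarrow> 'a^'m::finite^'m"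
  assumes l1: "levels l1 r" and l2: "levels l2 r"
    and iso: "semigroup_iso_betw (coord_phi l1) (coord_phi l2) f"
  shows "semigroup_iso_betw (coord_phi (\<lambda>p. r + 1 - l1 p)) (coord_phi (\<lambda>q. r + 1 - l2 q))
    (\<lambda>a. transpose (f (transpose a)))"
proof -
  have bij: "bij_betw f (coord_phi l1) (coord_phi l2)"
    and hom: "\<And>a b. a \<in> coord_phi l1 \<Longrightarrow> b \<in> coord_phi l1 \<Longrightarrow> f (a ** b) = f a ** f b"
    using iso by (auto simp: semigroup_iso_betw_def)
  have "bij_betw (transpose \<circ> f \<circ> transpose) (coord_phi (\<lambda>p. r + 1 - l1 p)) (coord_phi (\<lambda>q. r + 1 - l2 q))"
    using levels.bij_betw_transpose_coord_phi(2)[OF l1] bij levels.bij_betw_transpose_coord_phi(1)[OF l2]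
    by (intro bij_betw_trans)
  moreover have "transpose (f (transpose (a ** b))) = transpose (f (transpose a)) ** transpose (f (transpose b))"
    if "a \<in> coord_phi (\<lambda>p. r + 1 - l1 p)" "b \<in> coord_phi (\<lambda>p. r + 1 - l1 p)" for a b
  proof -
    have "transpose a \<in> coord_phi l1" "transpose b \<in> coord_phi l1"
      using that levels.transpose_in_coord_phi_reverse_iff[OF l1] by (metis transpose_transpose)+
    then show ?thesis by (simp add: matrix_transpose_mul hom)
  qed
  ultimately show ?thesis by (simp add: semigroup_iso_betw_def comp_def)
qed

lemma level_one_card_eq_if_iso:
  fixes f :: "'a::field^'n::finite^'n \<Rightarrow> 'a^'m::finite^'m"
  assumes l1: "levels_ge4 l1 r" and l2: "levels_ge4 l2 r"
    and iso: "semigroup_iso_betw (coord_phi l1) (coord_phi l2) f"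
  shows "card {p. l1 p = 1} = card {q. l2 q = 1}"
proof -
  interpret zero_semigroup_iso "coord_phi l1" "(**)" "0::'a^'n^'n" "coord_phi l2" "(**)" "0::'a^'m^'m" f
    using iso by (rule zero_semigroup_iso_coord_phi)
  have "k \<le> card {q. l2 q = 1} \<longleftrightarrow> k \<le> card {p. l1 p = 1}" for k
    using has_independent_points_iff[of k] levels_ge4.has_independent_points_iff_card[OF l1, of k]
      levels_ge4.has_independent_points_iff_card[OF l2, of k]
    by blast
  then show ?thesis using le_antisym by blast
qed

lemma middle_level_card_eq_if_iso:
  fixes f :: "'a::field^'n::finite^'n \<Rightarrow> 'a^'m::finite^'m"
  assumes l1: "levels l1 r" and l2: "levels l2 r"
    and iso: "semigroup_iso_betw (coord_phi l1) (coord_phi l2) f"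
    and t: "1 < t" "t < r"
  shows "card {p. l1 p = t} = card {q. l2 q = t}"
proof -
  interpret zero_semigroup_iso "coord_phi l1" "(**)" "0::'a^'n^'n" "coord_phi l2" "(**)" "0::'a^'m^'m" f
    using iso by (rule zero_semigroup_iso_coord_phi)
  have "k \<le> card {q. l2 q = t} \<longleftrightarrow> k \<le> card {p. l1 p = t}" for k
    using has_biorthogonal_system_iff[of t "r - t + 1" k]
      levels.has_biorthogonal_system_iff_card[OF l1 t, of k]
      levels.has_biorthogonal_system_iff_card[OF l2 t, of k]
    by blast
  then show ?thesis using le_antisym by blast
qed

lemma level_card_eq_if_iso:
  fixes f :: "'a::field^'n::finite^'n \<Rightarrow> 'a^'m::finite^'m"
  assumes l1: "levels_ge4 l1 r" and l2: "levels_ge4 l2 r"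
    and iso: "semigroup_iso_betw (coord_phi l1) (coord_phi l2) f"
  shows "card {p. l1 p = i} = card {q. l2 q = i}"
proof -
  have levels: "levels l1 r" "levels l2 r"
    using l1 l2 by (simp_all add: levels_ge4_def)
  consider "i = 1" | "i = r" | "1 < i \<and> i < r" | "i < 1 \<or> r < i"
    by linarith
  then show ?thesis
  proof cases
    case 1
    then show ?thesis using level_one_card_eq_if_iso[OF l1 l2 iso] by simp
  next
    case 2
    have "card {p. r + 1 - l1 p = 1} = card {q. r + 1 - l2 q = 1}"
      using levels_ge4.levels_ge4_reverse[OF l1] levels_ge4.levels_ge4_reverse[OF l2]
        semigroup_iso_betw_transpose[OF levels iso]
      by (rule level_one_card_eq_if_iso)
    moreover have top: "{p. r + 1 - l p = 1} = {p. l p = r}" if "levels l r" for l :: "'k::finite \<Rightarrow> nat"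
    proof (rule Collect_cong)
      fix p show "r + 1 - l p = 1 \<longleftrightarrow> l p = r" using levels.lev_le[OF that, of p] by linarith
    qed
    ultimately show ?thesis using 2 top[OF levels(1)] top[OF levels(2)] by simp
  next
    case 3
    then show ?thesis using middle_level_card_eq_if_iso[OF levels iso] by simp
  next
    case 4
    then show ?thesis using levels.level_set_empty[OF levels(1)] levels.level_set_empty[OF levels(2)] by simp
  qed
qed

lemma level_preserving_bij:
  fixes l1 :: "'n::finite \<Rightarrow> nat" and l2 :: "'m::finite \<Rightarrow> nat"
  assumes cards: "\<And>i. card {p. l1 p = i} = card {q. l2 q = i}"
  obtains \<sigma> where "bij \<sigma>" "\<And>p. l2 (\<sigma> p) = l1 p"
proof -
  have "\<forall>i. \<exists>h. bij_betw h {p. l1 p = i} {q. l2 q = i}"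
    using cards by (simp add: finite_same_card_bij)
  then obtain H where H: "\<And>i. bij_betw (H i) {p. l1 p = i} {q. l2 q = i}" by metis
  define \<sigma> where "\<sigma> p = H (l1 p) p" for p
  have level: "l2 (\<sigma> p) = l1 p" for p
    using bij_betw_apply[OF H, of p "l1 p"] by (simp add: \<sigma>_def)
  have "inj \<sigma>"
  proof (rule injI)
    fix p p' assume eq: "\<sigma> p = \<sigma> p'"
    then have "l1 p' = l1 p" using level by metis
    then show "p = p'"
      using eq bij_betw_imp_inj_on[OF H[of "l1 p"]] by (auto simp: \<sigma>_def inj_on_def)
  qed
  moreover have "surj \<sigma>"
  proof -
    have "q \<in> range \<sigma>" for q
    proof -
      obtain p where "l1 p = l2 q" "q = H (l2 q) p"
        using bij_betw_imp_surj_on[OF H[of "l2 q"]] by force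
      then have "q = \<sigma> p" by (simp add: \<sigma>_def)
      then show ?thesis by blast
    qed
    then show ?thesis by blast
  qed
  ultimately show ?thesis using that level by (simp add: bij_def)
qed

lemma coord_phi_isomorphic_if_level_cards:
  fixes l1 :: "'n::finite \<Rightarrow> nat" and l2 :: "'m::finite \<Rightarrow> nat"
  assumes "\<And>i. card {p. l1 p = i} = card {q. l2 q = i}"
  shows "semigroups_isomorphic (coord_phi l1 :: ('a::semiring_1^'n^'n) set) (coord_phi l2)"
proof -
  obtain \<sigma> where \<sigma>: "bij \<sigma>" "\<And>p. l2 (\<sigma> p) = l1 p"
    using level_preserving_bij[OF assms] by blast
  define \<tau> where "\<tau> = inv \<sigma>"
  have \<sigma>\<tau>: "\<sigma> (\<tau> q) = q" and \<tau>\<sigma>: "\<tau> (\<sigma> p) = p" for p q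
    using \<sigma>(1) by (simp_all add: \<tau>_def bij_is_surj bij_is_inj surj_f_inv_f)
  have \<tau>_level: "l1 (\<tau> q) = l2 q" for q using \<sigma>(2)[of "\<tau> q"] \<sigma>\<tau> by simp
  have bij_\<tau>: "bij \<tau>" unfolding \<tau>_def using \<sigma>(1) by (rule bij_imp_bij_inv)
  define F :: "'a^'n^'n \<Rightarrow> 'a^'m^'m" where "F a = (\<chi> i j. a $ \<tau> i $ \<tau> j)" for a
  define G :: "'a^'m^'m \<Rightarrow> 'a^'n^'n" where "G b = (\<chi> p q. b $ \<sigma> p $ \<sigma> q)" for b
  have "bij_betw F (coord_phi l1) (coord_phi l2)"
  proof (rule bij_betw_byWitness[where f' = G])
    show "\<forall>a\<in>coord_phi l1. G (F a) = a" by (simp add: F_def G_def \<tau>\<sigma> vec_eq_iff)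
    show "\<forall>b\<in>coord_phi l2. F (G b) = b" by (simp add: F_def G_def \<sigma>\<tau> vec_eq_iff)
    show "F ` coord_phi l1 \<subseteq> coord_phi l2" by (auto simp: F_def coord_phi_def \<tau>_level[symmetric])
    show "G ` coord_phi l2 \<subseteq> coord_phi l1" by (auto simp: G_def coord_phi_def \<sigma>(2)[symmetric])
  qed
  moreover have "F (a ** b) = F a ** F b" for a b
  proof -
    have "(\<Sum>k\<in>UNIV. a $ \<tau> i $ k * b $ k $ \<tau> j) = (\<Sum>k\<in>UNIV. a $ \<tau> i $ \<tau> k * b $ \<tau> k $ \<tau> j)" for i j
      using bij_\<tau> by (rule sum.reindex_bij_betw[symmetric])
    then show ?thesis by (simp add: F_def matrix_matrix_mult_def vec_eq_iff)
  qed
  ultimately show ?thesis unfolding semigroups_isomorphic_def semigroup_iso_betw_def by blast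
qed

lemma coord_phi_isomorphic_iff_level_cards:
  fixes l1 :: "'n::finite \<Rightarrow> nat" and l2 :: "'m::finite \<Rightarrow> nat"
  assumes "levels_ge4 l1 r" "levels_ge4 l2 r"
  shows "semigroups_isomorphic (coord_phi l1 :: ('a::field^'n^'n) set) (coord_phi l2) \<longleftrightarrow>
    (\<forall>i. card {p. l1 p = i} = card {q. l2 q = i})"
proof
  assume "semigroups_isomorphic (coord_phi l1 :: ('a::field^'n^'n) set) (coord_phi l2)"
  then obtain f :: "'a^'n^'n \<Rightarrow> 'a^'m^'m" where "semigroup_iso_betw (coord_phi l1) (coord_phi l2) f"
    unfolding semigroups_isomorphic_def by blast
  then show "\<forall>i. card {p. l1 p = i} = card {q. l2 q = i}"
    using level_card_eq_if_iso[OF assms] by blast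
qed (rule coord_phi_isomorphic_if_level_cards, blast)

section \<open>Flags in adapted coordinates\<close>

lemma flag_subspace: "is_flag r V \<Longrightarrow> j \<le> r \<Longrightarrow> vec.subspace (V j)"
  by (simp add: is_flag_def)

lemma flag_strict: "is_flag r V \<Longrightarrow> 1 \<le> j \<Longrightarrow> j \<le> r \<Longrightarrow> V (j - 1) \<subset> V j"
  by (simp add: is_flag_def)

lemma flag_mono:
  assumes "is_flag r V" "i \<le> j" "j \<le> r"
  shows "V i \<subseteq> V j"
  using assms(2,3)
proof (induction j)
  case (Suc j)
  show ?case
  proof (cases "i = Suc j")
    case False
    then have "V i \<subseteq> V j" using Suc by simp
    also have "V j \<subseteq> V (Suc j)" using flag_strict[OF assms(1), of "Suc j"] Suc.prems by auto
    finally show ?thesis .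
  qed simp
qed simp

lemma flag_adapted_basis:
  fixes V :: "nat \<Rightarrow> ('a::field^'n::finite) set"
  assumes flag: "is_flag r V"
  obtains B where "vec.independent B" "\<And>j. j \<le> r \<Longrightarrow> V j \<subseteq> vec.span (B \<inter> V j)"
proof -
  have "j \<le> r \<Longrightarrow> \<exists>B. B \<subseteq> V j \<and> vec.independent B \<and> (\<forall>i\<le>j. V i \<subseteq> vec.span (B \<inter> V i))" for j
  proof (induction j)
    case 0
    then show ?case using flag by (auto simp: is_flag_def vec.independent_empty)
  next
    case (Suc j)
    then obtain B where B: "B \<subseteq> V j" "vec.independent B" "\<forall>i\<le>j. V i \<subseteq> vec.span (B \<inter> V i)" by auto
    have "B \<subseteq> V (Suc j)" using B(1) flag_mono[OF flag, of j "Suc j"] Suc.prems by auto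
    then obtain B' where B': "B \<subseteq> B'" "B' \<subseteq> V (Suc j)" "vec.independent B'" "V (Suc j) \<subseteq> vec.span B'"
      using vec.maximal_independent_subset_extend B(2) by metis
    have "V i \<subseteq> vec.span (B' \<inter> V i)" if "i \<le> Suc j" for i
    proof (cases "i = Suc j")
      case True
      then show ?thesis using B'(2,4) by (simp add: Int_absorb2)
    next
      case False
      then have "V i \<subseteq> vec.span (B \<inter> V i)" using B(3) that by simp
      also have "\<dots> \<subseteq> vec.span (B' \<inter> V i)" using B'(1) by (intro vec.span_mono) blast
      finally show ?thesis .
    qed
    then show ?case using B' by blast
  qed
  then show ?thesis using that by blast
qed

locale adapted_basis =
  fixes r :: nat and V :: "nat \<Rightarrow> ('a::field^'n::finite) set" and \<beta> :: "'n \<Rightarrow> 'a^'n"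
  assumes flag: "is_flag r V"
    and inj: "inj \<beta>"
    and independent: "vec.independent (range \<beta>)"
    and adapted: "\<And>j. j \<le> r \<Longrightarrow> V j \<subseteq> vec.span (range \<beta> \<inter> V j)"
begin

definition level :: "'n \<Rightarrow> nat" where
  "level q = (LEAST j. \<beta> q \<in> V j)"

lemma top_eq_UNIV: "V r = UNIV"
  using flag by (simp add: is_flag_def)

lemma mem_iff_level_le: "j \<le> r \<Longrightarrow> \<beta> q \<in> V j \<longleftrightarrow> level q \<le> j"
proof
  assume "level q \<le> j" "j \<le> r"
  moreover have "\<beta> q \<in> V (level q)"
    unfolding level_def by (rule LeastI[of _ r]) (simp add: top_eq_UNIV)
  ultimately show "\<beta> q \<in> V j" using flag_mono[OF flag] by blast
qed (simp add: level_def Least_le)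

lemma level_le: "level q \<le> r"
  using mem_iff_level_le[of r q] by (simp add: top_eq_UNIV)

lemma range_inter_eq: "j \<le> r \<Longrightarrow> range \<beta> \<inter> V j = \<beta> ` {q. level q \<le> j}"
  using mem_iff_level_le by auto

lemma span_level_le:
  assumes "j \<le> r"
  shows "vec.span (\<beta> ` {q. level q \<le> j}) = V j"
proof
  have "\<beta> ` {q. level q \<le> j} \<subseteq> V j" using range_inter_eq[OF assms] by blast
  then show "vec.span (\<beta> ` {q. level q \<le> j}) \<subseteq> V j"
    using flag_subspace[OF flag assms] by (rule vec.span_minimal)
  show "V j \<subseteq> vec.span (\<beta> ` {q. level q \<le> j})"
    using adapted[OF assms] range_inter_eq[OF assms] by simp
qed

lemma levels_level: "levels level r"
proof
  fix q
  have "\<beta> q \<noteq> 0"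
  proof
    assume "\<beta> q = 0"
    then have "0 \<in> range \<beta>" by (metis rangeI)
    then show False using vec.dependent_zero[OF \<open>0 \<in> range \<beta>\<close>] independent by simp
  qed
  then have "\<beta> q \<notin> V 0" using flag by (simp add: is_flag_def)
  then show "1 \<le> level q" using mem_iff_level_le[of 0 q] by simp
  show "level q \<le> r" by (rule level_le)
next
  fix i assume i: "1 \<le> i" "i \<le> r"
  show "\<exists>q. level q = i"
  proof (rule ccontr)
    assume "\<nexists>q. level q = i"
    then have not_i: "level q \<noteq> i" for q by blast
    have "level q \<le> i \<longleftrightarrow> level q \<le> i - 1" for q using not_i[of q] i(1) by linarith
    then have "{q. level q \<le> i} = {q. level q \<le> i - 1}" by simp
    then have "V i = V (i - 1)" using span_level_le[of i] span_level_le[of "i - 1"] i by simp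
    then show False using flag_strict[OF flag i] by simp
  qed
qed

definition basis_matrix :: "'a^'n^'n" where
  "basis_matrix = (\<chi> i q. \<beta> q $ i)"

lemma basis_matrix_mult: "basis_matrix *v c = (\<Sum>q\<in>UNIV. c $ q *s \<beta> q)"
proof -
  have "column q basis_matrix = \<beta> q" for q by (simp add: basis_matrix_def column_def vec_eq_iff)
  then show ?thesis by (simp add: matrix_mult_sum)
qed

lemma flag_eq_image_coord_flag:
  assumes j: "j \<le> r"
  shows "V j = (\<lambda>c. basis_matrix *v c) ` coord_flag level j"
proof
  show "(\<lambda>c. basis_matrix *v c) ` coord_flag level j \<subseteq> V j"
  proof clarify
    fix c :: "'a^'n" assume c: "c \<in> coord_flag level j"
    have "c $ q *s \<beta> q \<in> V j" for q
    proof (cases "c $ q = 0")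
      case False
      then have "\<beta> q \<in> V j" using c j mem_iff_level_le by (simp add: coord_flag_def)
      then show ?thesis using flag_subspace[OF flag j] by (rule vec.subspace_scale[rotated])
    qed (simp add: vec.subspace_0[OF flag_subspace[OF flag j]])
    then show "basis_matrix *v c \<in> V j"
      unfolding basis_matrix_mult by (intro vec.subspace_sum flag_subspace[OF flag j])
  qed
next
  show "V j \<subseteq> (\<lambda>c. basis_matrix *v c) ` coord_flag level j"
  proof
    fix v assume "v \<in> V j"
    then obtain u where u: "v = (\<Sum>b\<in>\<beta> ` {q. level q \<le> j}. u b *s b)"
      using span_level_le[OF j] vec.span_finite[of "\<beta> ` {q. level q \<le> j}"] by auto
    define c where "c = (\<chi> q. if level q \<le> j then u (\<beta> q) else 0)"
    have "c \<in> coord_flag level j" by (simp add: c_def coord_flag_def)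
    moreover have "basis_matrix *v c = v"
    proof -
      have "basis_matrix *v c = (\<Sum>q\<in>{q. level q \<le> j}. u (\<beta> q) *s \<beta> q)"
        unfolding basis_matrix_mult c_def by (simp add: if_distrib[of "\<lambda>x. x *s _"] sum.If_cases)
      also have "\<dots> = v"
        unfolding u using inj by (simp add: sum.reindex inj_on_def)
      finally show ?thesis .
    qed
    ultimately show "v \<in> (\<lambda>c. basis_matrix *v c) ` coord_flag level j" by blast
  qed
qed

lemma basis_matrix_invertible:
  obtains M' where "M' ** basis_matrix = mat 1" "basis_matrix ** M' = mat 1"
proof -
  have "columns basis_matrix = range \<beta>"
    by (auto simp: columns_def column_def basis_matrix_def vec_eq_iff)
  moreover have "vec.span (range \<beta>) = UNIV"
    using adapted[of r] top_eq_UNIV by auto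
  ultimately obtain M' where "basis_matrix ** M' = mat 1"
    using matrix_right_invertible_span_columns by metis
  then show ?thesis using that matrix_left_right_inverse by blast
qed

end

lemma flag_coordinates:
  fixes V :: "nat \<Rightarrow> ('a::field^'n::finite) set"
  assumes flag: "is_flag r V"
  obtains lev :: "'n \<Rightarrow> nat" and M M' :: "'a^'n^'n"
  where "levels lev r" "M' ** M = mat 1" "M ** M' = mat 1"
    "\<And>j. j \<le> r \<Longrightarrow> V j = (\<lambda>c. M *v c) ` coord_flag lev j"
proof -
  obtain B where B: "vec.independent B" "\<And>j. j \<le> r \<Longrightarrow> V j \<subseteq> vec.span (B \<inter> V j)"
    using flag_adapted_basis[OF flag] by blast
  have "vec.span B = UNIV" using B(2)[of r] flag by (auto simp: is_flag_def)
  then have "card B = CARD('n)"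
    using B(1) vec.basis_card_eq_dim[of B UNIV] by (simp add: vec_dim_card card_cart_basis)
  then obtain \<beta> :: "'n \<Rightarrow> 'a^'n" where "bij_betw \<beta> UNIV B"
    using finite_same_card_bij[OF finite vec.finiteI_independent[OF B(1)]] by metis
  then have "adapted_basis r V \<beta>"
    using flag B by unfold_locales (auto simp: bij_betw_def)
  then interpret adapted_basis r V \<beta> .
  obtain M' where inv: "M' ** basis_matrix = mat 1" "basis_matrix ** M' = mat 1"
    by (rule basis_matrix_invertible)
  show ?thesis by (rule that[OF levels_level inv flag_eq_image_coord_flag])
qed

lemma flag_phi_conj_iff:
  assumes inv: "M' ** M = mat 1" "M ** M' = mat 1"
    and V: "\<And>j. j \<le> r \<Longrightarrow> V j = (\<lambda>c. M *v c) ` U j"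
  shows "a \<in> flag_phi r V \<longleftrightarrow> M' ** a ** M \<in> flag_phi r U"
proof -
  have step_iff: "(\<lambda>x. a *v x) ` ((\<lambda>c. M *v c) ` U i) \<subseteq> (\<lambda>c. M *v c) ` U (i - 1) \<longleftrightarrow>
      (\<lambda>x. (M' ** a ** M) *v x) ` U i \<subseteq> U (i - 1)" for i
  proof
    assume sub: "(\<lambda>x. a *v x) ` ((\<lambda>c. M *v c) ` U i) \<subseteq> (\<lambda>c. M *v c) ` U (i - 1)"
    show "(\<lambda>x. (M' ** a ** M) *v x) ` U i \<subseteq> U (i - 1)"
    proof clarify
      fix u assume "u \<in> U i"
      then obtain w where w: "w \<in> U (i - 1)" "a *v (M *v u) = M *v w" using sub by blast
      have "(M' ** a ** M) *v u = M' *v (a *v (M *v u))"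
        by (simp add: matrix_vector_mul_assoc matrix_mul_assoc)
      also have "\<dots> = M' *v (M *v w)" by (simp only: w(2))
      also have "\<dots> = w" using inv(1) by (simp add: matrix_vector_mul_assoc)
      finally show "(M' ** a ** M) *v u \<in> U (i - 1)" using w(1) by simp
    qed
  next
    assume "(\<lambda>x. (M' ** a ** M) *v x) ` U i \<subseteq> U (i - 1)"
    moreover have "a *v (M *v u) = M *v ((M' ** a ** M) *v u)" for u
      using inv(2) by (simp add: matrix_vector_mul_assoc matrix_mul_assoc)
    ultimately show "(\<lambda>x. a *v x) ` ((\<lambda>c. M *v c) ` U i) \<subseteq> (\<lambda>c. M *v c) ` U (i - 1)"
      by auto
  qed
  have "(\<lambda>x. a *v x) ` V i \<subseteq> V (i - 1) \<longleftrightarrow> (\<lambda>x. (M' ** a ** M) *v x) ` U i \<subseteq> U (i - 1)"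
    if "i \<in> {1..r}" for i
  proof -
    have "V i = (\<lambda>c. M *v c) ` U i" "V (i - 1) = (\<lambda>c. M *v c) ` U (i - 1)"
      using that V by auto
    then show ?thesis using step_iff[of i] by simp
  qed
  then show ?thesis unfolding flag_phi_def mem_Collect_eq by (rule ball_cong[OF refl])
qed

lemma semigroup_iso_betw_conj:
  fixes M M' :: "'a::semiring_1^'n::finite^'n"
  assumes inv: "M' ** M = mat 1" "M ** M' = mat 1"
    and iff: "\<And>a. a \<in> S \<longleftrightarrow> M' ** a ** M \<in> T"
  shows "semigroup_iso_betw S T (\<lambda>a. M' ** a ** M)"
proof -
  have cancel: "X ** M ** M' = X" "X ** M' ** M = X" for X :: "'a^'n^'n"
    using inv by (simp_all add: matrix_mul_assoc[symmetric])
  have "bij_betw (\<lambda>a. M' ** a ** M) S T"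
    by (rule bij_betw_byWitness[where f' = "\<lambda>b. M ** b ** M'"])
      (auto simp: iff matrix_mul_assoc cancel inv)
  moreover have "M' ** (a ** b) ** M = (M' ** a ** M) ** (M' ** b ** M)" for a b
    by (simp add: matrix_mul_assoc cancel)
  ultimately show ?thesis by (simp add: semigroup_iso_betw_def)
qed

lemma (in levels) flag_phi_coord_flag: "flag_phi r (coord_flag lev) = (coord_phi lev :: ('a::field^'n^'n) set)"
proof (intro equalityI subsetI)
  fix a :: "'a^'n^'n" assume a: "a \<in> flag_phi r (coord_flag lev)"
  show "a \<in> coord_phi lev" unfolding coord_phi_def
  proof (intro CollectI allI impI)
    fix p q assume nz: "a $ p $ q \<noteq> 0"
    have "axis q 1 \<in> coord_flag lev (lev q)" by (simp add: coord_flag_def axis_def)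
    moreover have "lev q \<in> {1..r}" using lev_pos lev_le by simp
    ultimately have "column q a \<in> coord_flag lev (lev q - 1)"
      using a unfolding flag_phi_def by (force simp: matrix_vector_mult_axis_one)
    then have "lev p \<le> lev q - 1" using nz by (simp add: coord_flag_def column_def)
    then show "lev p < lev q" using lev_pos[of q] by linarith
  qed
next
  fix a :: "'a^'n^'n" assume a: "a \<in> coord_phi lev"
  have "a *v c \<in> coord_flag lev (i - 1)" if c: "c \<in> coord_flag lev i" for i c
    unfolding coord_flag_def
  proof (intro CollectI allI impI)
    fix p assume "(a *v c) $ p \<noteq> 0"
    then obtain k where "a $ p $ k \<noteq> 0" "c $ k \<noteq> 0" by (rule matrix_vector_mult_nonzero_entry)
    then have "lev p < lev k" "lev k \<le> i" using a c by (auto simp: coord_phi_def coord_flag_def)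
    then show "lev p \<le> i - 1" by simp
  qed
  then show "a \<in> flag_phi r (coord_flag lev)" by (auto simp: flag_phi_def)
qed

lemma flag_sig_eq_level_cards:
  fixes V :: "nat \<Rightarrow> ('a::field^'n::finite) set" and lev :: "'n \<Rightarrow> nat"
  assumes "levels lev r" "M' ** M = mat 1" "\<And>j. j \<le> r \<Longrightarrow> V j = (\<lambda>c. M *v c) ` coord_flag lev j"
  shows "flag_sig r V = map (\<lambda>i. card {p. lev p = Suc i}) [0..<r]"
proof -
  have "inj ((*v) M)"
    using assms(2) by (metis injI matrix_vector_mul_assoc matrix_vector_mul_lid)
  then have dim: "vec.dim (V j) = card {p. lev p \<le> j}" if "j \<le> r" for j
  proof -
    have "vec.dim (V j) = vec.dim (coord_flag lev j :: ('a^'n) set)"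
      using assms(3)[OF that] vec.dim_image_eq[OF matrix_vector_mul_linear_gen, of M "coord_flag lev j"]
        \<open>inj ((*v) M)\<close> by (simp add: inj_on_subset)
    also have "coord_flag lev j = {x :: 'a^'n. \<forall>i. i \<notin> {p. lev p \<le> j} \<longrightarrow> x $ i = 0}"
      by (auto simp: coord_flag_def)
    also have "vec.dim \<dots> = card {p. lev p \<le> j}" by (rule dim_substandard_cart)
    finally show ?thesis .
  qed
  have "card {p. lev p = Suc i} = card {p. lev p \<le> Suc i} - card {p. lev p \<le> i}" for i
  proof -
    have "{p. lev p = Suc i} = {p. lev p \<le> Suc i} - {p. lev p \<le> i}" by auto
    then show ?thesis by (simp add: card_Diff_subset subset_eq)
  qed
  then show ?thesis unfolding flag_sig_def using dim by simp
qed

lemma semigroups_isomorphic_trans: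
  fixes S :: "('a::semiring_1^'n::finite^'n) set" and T :: "('a^'m::finite^'m) set"
    and U :: "('a^'k::finite^'k) set"
  assumes "semigroups_isomorphic S T" "semigroups_isomorphic T U"
  shows "semigroups_isomorphic S U"
proof -
  obtain f g where f: "semigroup_iso_betw S T f" and g: "semigroup_iso_betw T U g"
    using assms unfolding semigroups_isomorphic_def by blast
  have "bij_betw (g \<circ> f) S U"
    using f g unfolding semigroup_iso_betw_def by (blast intro: bij_betw_trans)
  moreover have "(g \<circ> f) (a ** b) = (g \<circ> f) a ** (g \<circ> f) b" if "a \<in> S" "b \<in> S" for a b
  proof -
    have "f a \<in> T" "f b \<in> T" using f that unfolding semigroup_iso_betw_def by (auto intro: bij_betw_apply)
    then show ?thesis using f g that unfolding semigroup_iso_betw_def by simp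
  qed
  ultimately show ?thesis unfolding semigroups_isomorphic_def semigroup_iso_betw_def by blast
qed

lemma semigroups_isomorphic_iff_of_isomorphic:
  fixes S :: "('a::semiring_1^'n::finite^'n) set" and S' :: "('a^'k::finite^'k) set"
    and T :: "('a^'m::finite^'m) set" and T' :: "('a^'l::finite^'l) set"
  assumes "semigroups_isomorphic S S'" "semigroups_isomorphic S' S"
    and "semigroups_isomorphic T T'" "semigroups_isomorphic T' T"
  shows "semigroups_isomorphic S T \<longleftrightarrow> semigroups_isomorphic S' T'"
proof
  assume "semigroups_isomorphic S T"
  with assms(2) have "semigroups_isomorphic S' T" by (rule semigroups_isomorphic_trans)
  then show "semigroups_isomorphic S' T'" using assms(3) by (rule semigroups_isomorphic_trans)
next
  assume "semigroups_isomorphic S' T'"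
  with assms(1) have "semigroups_isomorphic S T'" by (rule semigroups_isomorphic_trans)
  then show "semigroups_isomorphic S T" using assms(4) by (rule semigroups_isomorphic_trans)
qed

lemma flag_phi_isomorphic_coord_phi:
  fixes V :: "nat \<Rightarrow> ('a::field^'n::finite) set"
  assumes "is_flag r V"
  obtains lev :: "'n \<Rightarrow> nat" where "levels lev r"
    "flag_sig r V = map (\<lambda>i. card {p. lev p = Suc i}) [0..<r]"
    "semigroups_isomorphic (flag_phi r V) (coord_phi lev)"
    "semigroups_isomorphic (coord_phi lev) (flag_phi r V)"
proof (rule flag_coordinates[OF assms])
  fix lev :: "'n \<Rightarrow> nat" and M M' :: "'a^'n^'n"
  assume lev: "levels lev r" and inv: "M' ** M = mat 1" "M ** M' = mat 1"
    and V: "\<And>j. j \<le> r \<Longrightarrow> V j = (\<lambda>c. M *v c) ` coord_flag lev j"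
  have phi: "a \<in> flag_phi r V \<longleftrightarrow> M' ** a ** M \<in> coord_phi lev" for a
  proof -
    have "a \<in> flag_phi r V \<longleftrightarrow> M' ** a ** M \<in> flag_phi r (coord_flag lev)"
      using V by (rule flag_phi_conj_iff[OF inv])
    then show ?thesis by (simp only: levels.flag_phi_coord_flag[OF lev])
  qed
  have "semigroup_iso_betw (flag_phi r V) (coord_phi lev) (\<lambda>a. M' ** a ** M)"
    using inv phi by (rule semigroup_iso_betw_conj)
  moreover have "semigroup_iso_betw (coord_phi lev) (flag_phi r V) (\<lambda>b. M ** b ** M')"
  proof (rule semigroup_iso_betw_conj[OF inv(2,1)])
    fix b
    have "M' ** (M ** b ** M') ** M = b"
      using inv by (simp add: matrix_mul_assoc[symmetric]) (simp add: matrix_mul_assoc)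
    then show "b \<in> coord_phi lev \<longleftrightarrow> M ** b ** M' \<in> flag_phi r V" using phi by simp
  qed
  ultimately show thesis
    using that lev flag_sig_eq_level_cards[OF lev inv(1) V] unfolding semigroups_isomorphic_def by blast
qed

lemma level_cards_eq_iff:
  assumes "levels l1 r" "levels l2 r"
  shows "(\<forall>i. card {p. l1 p = i} = card {q. l2 q = i}) \<longleftrightarrow>
    map (\<lambda>i. card {p. l1 p = Suc i}) [0..<r] = map (\<lambda>i. card {q. l2 q = Suc i}) [0..<r]"
proof
  assume "map (\<lambda>i. card {p. l1 p = Suc i}) [0..<r] = map (\<lambda>i. card {q. l2 q = Suc i}) [0..<r]"
  then have inside: "card {p. l1 p = Suc i} = card {q. l2 q = Suc i}" if "i < r" for i
    using that by (simp add: map_eq_conv)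
  show "\<forall>i. card {p. l1 p = i} = card {q. l2 q = i}"
  proof
    fix i
    show "card {p. l1 p = i} = card {q. l2 q = i}"
    proof (cases "1 \<le> i \<and> i \<le> r")
      case True
      then have "i - 1 < r" "Suc (i - 1) = i" by auto
      then show ?thesis using inside[of "i - 1"] by simp
    next
      case False
      then have "i < 1 \<or> r < i" by auto
      then show ?thesis
        using levels.level_set_empty[OF assms(1)] levels.level_set_empty[OF assms(2)] by simp
    qed
  qed
qed simp

theorem corollary23:
  fixes V :: "nat \<Rightarrow> ('a::field ^ 'n) set"
    and W :: "nat \<Rightarrow> ('a ^ 'm) set"
    and r :: nat
  assumes "r > 3"
    and "is_flag r V"
    and "is_flag r W"
  shows "semigroups_isomorphic (flag_phi r V) (flag_phi r W) \<longleftrightarrow> flag_sig r V = flag_sig r W"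
proof -
  obtain l1 :: "'n \<Rightarrow> nat" where l1: "levels l1 r"
    and sig1: "flag_sig r V = map (\<lambda>i. card {p. l1 p = Suc i}) [0..<r]"
    and iso1: "semigroups_isomorphic (flag_phi r V) (coord_phi l1)"
      "semigroups_isomorphic (coord_phi l1) (flag_phi r V)"
    by (rule flag_phi_isomorphic_coord_phi[OF assms(2)])
  obtain l2 :: "'m \<Rightarrow> nat" where l2: "levels l2 r"
    and sig2: "flag_sig r W = map (\<lambda>i. card {p. l2 p = Suc i}) [0..<r]"
    and iso2: "semigroups_isomorphic (flag_phi r W) (coord_phi l2)"
      "semigroups_isomorphic (coord_phi l2) (flag_phi r W)"
    by (rule flag_phi_isomorphic_coord_phi[OF assms(3)])
  have ge4: "levels_ge4 l1 r" "levels_ge4 l2 r"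
    using l1 l2 assms(1) by (simp_all add: levels_ge4_def levels_ge4_axioms_def)
  have "semigroups_isomorphic (flag_phi r V) (flag_phi r W) \<longleftrightarrow>
      semigroups_isomorphic (coord_phi l1 :: ('a^'n^'n) set) (coord_phi l2)"
    by (rule semigroups_isomorphic_iff_of_isomorphic[OF iso1 iso2])
  also have "\<dots> \<longleftrightarrow> (\<forall>i. card {p. l1 p = i} = card {q. l2 q = i})"
    by (rule coord_phi_isomorphic_iff_level_cards[OF ge4])
  also have "\<dots> \<longleftrightarrow> flag_sig r V = flag_sig r W"
    unfolding sig1 sig2 by (rule level_cards_eq_iff[OF l1 l2])
  finally show ?thesis .
qed

end
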